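(* For minimizing the total weighted completion time of jobs with online chain precedence constraints on a single machine, there is a non-clairvoyant algorithm with (static) predicted chain weights with a competitive ratio of at most \[O(1)\cdot\min\left\{1+\frac{\mathrm{Opt}(\mathcal C_o)+\omega\cdot\mathrm{Opt}(\mathcal C_u)}{\mathrm{Opt}},\ \omega\right\}.\]
   Context: Problem (non-clairvoyant single-machine scheduling with online precedence constraints): jobs with processing requirements $p_j\ge0$ (unknown to the algorithm) and weights $w_j\ge0$; the precedence graph is a set $\mathcal C$ of disjoint chains; a job is revealed (with its weight) and may be processed only once its predecessor in its chain is completed. Time is discrete; rates $R_j^t\ge0$, $\sum_jR_j^t\le1$; $C_j$ is the first $t$ with $\sum_{t'\le t}R_j^{t'}\ge p_j$. Objective: minimize $\sum_jw_jC_j$; $\mathrm{Opt}$ is the offline optimum of the instance and $\mathrm{Opt}(\mathcal I)$ denotes the optimal objective value of a chain instance $\mathcal I$. The width $\omega$ is the number of chains. For each chain $c$ with true total weight $W_c=\sum_{j\in c}w_j$, the algorithm is given at time $0$ a prediction $\hat W_c$. Instances $\mathcal C_u$, $\mathcal C_o$: for every chain $c=[j_1,\dots,j_\ell]\in\mathcal C$: if $\hat W_c<W_c$, let $k$ be the smallest index with $\hat W_c\le\sum_{i=1}^k w_{j_i}$; add to $\mathcal C_u$ the chain $[\bot,j_{k+1},\dots,j_\ell]$, where $j_{k+1},\dots,j_\ell$ keep their weights and processing requirements, and $\bot$ is a new job of weight $\sum_{i=1}^k w_{j_i}-\hat W_c$ and processing requirement $\sum_{i=1}^k p_{j_i}$.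 If $\hat W_c>W_c$, add to $\mathcal C_o$ a chain consisting of a single job $\top$ of weight $\hat W_c-W_c$ and processing requirement $\sum_{i=1}^{\ell}p_{j_i}$. Chains with $\hat W_c=W_c$ contribute nothing to $\mathcal C_u,\mathcal C_o$. *)

theory Defs
  imports Complex_Main
begin

datatype job = Job (proc: real) (weight: real)

text \<open>An instance is a list of chains, each listing its jobs in precedence order. The jobs carry
  no names; the pair \<open>(c, i)\<close> denotes the job at position \<open>i\<close> (from 0) of chain \<open>c\<close>. The number of
  chains, i.e. the width of the precedence graph, is the length of the list.\<close>

type_synonym chain_instance = "job list list"

definition valid_instance :: "chain_instance \<Rightarrow> bool" where
  "valid_instance I \<longleftrightarrow>
     (\<forall>ch\<in>set I. ch \<noteq> [] \<and> (\<forall>j\<in>set ch. proc j \<ge> 0 \<and> weight j \<ge> 0))"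

definition job_ids :: "chain_instance \<Rightarrow> (nat \<times> nat) set" where
  "job_ids I = (SIGMA c:{..<length I}. {..<length (I ! c)})"

text \<open>\<open>R j t\<close> is the rate of job \<open>j\<close> in time step \<open>t \<in> {1, 2, \<dots>}\<close>, that is, during the interval
  from \<open>t - 1\<close> to \<open>t\<close>; the value at \<open>t = 0\<close> is irrelevant.\<close>

type_synonym schedule = "nat \<times> nat \<Rightarrow> nat \<Rightarrow> real"

definition received :: "schedule \<Rightarrow> nat \<Rightarrow> nat \<times> nat \<Rightarrow> real" where
  "received R t j = (\<Sum>s=1..t. R j s)"

text \<open>Here \<open>x\<close> gives the amount of processing that each job has received so far. Requiring the
  predecessors to be completed as well only matters for jobs with processing requirement 0, which
  complete together with their predecessor; see \<open>completion_time_proc_pos\<close> below.\<close>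

definition completed :: "chain_instance \<Rightarrow> (nat \<times> nat \<Rightarrow> real) \<Rightarrow> nat \<times> nat \<Rightarrow> bool" where
  "completed I x = (\<lambda>(c, i). \<forall>i'\<le>i. x (c, i') \<ge> proc (I ! c ! i'))"

definition completion_time :: "chain_instance \<Rightarrow> schedule \<Rightarrow> nat \<times> nat \<Rightarrow> nat" where
  "completion_time I R j = (LEAST t. completed I (received R t) j)"

definition feasible :: "chain_instance \<Rightarrow> schedule \<Rightarrow> bool" where
  "feasible I R \<longleftrightarrow>
     (\<forall>j\<in>job_ids I. \<forall>t\<ge>1. R j t \<ge> 0) \<and>
     (\<forall>t\<ge>1. (\<Sum>j\<in>job_ids I. R j t) \<le> 1) \<and>
     (\<forall>(c, i)\<in>job_ids I. \<forall>t\<ge>1. R (c, i) t > 0 \<longrightarrow>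
        (\<forall>i'<i. completed I (received R (t - 1)) (c, i'))) \<and>
     (\<forall>j\<in>job_ids I. \<exists>t. completed I (received R t) j)"

definition cost :: "chain_instance \<Rightarrow> schedule \<Rightarrow> real" where
  "cost I R = (\<Sum>(c, i)\<in>job_ids I. weight (I ! c ! i) * real (completion_time I R (c, i)))"

definition Opt :: "chain_instance \<Rightarrow> real" where
  "Opt I = Inf {cost I R | R. feasible I R}"

lemma completion_time_proc_pos:
  assumes "feasible I R" and "(c, i) \<in> job_ids I" and "proc (I ! c ! i) > 0"
  shows "completion_time I R (c, i) = (LEAST t. (\<Sum>s=1..t. R (c, i) s) \<ge> proc (I ! c ! i))"
proof -
  have "completed I (received R t) (c, i) \<longleftrightarrow> received R t (c, i) \<ge> proc (I ! c ! i)" for t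
  proof
    assume ge: "received R t (c, i) \<ge> proc (I ! c ! i)"
    have "\<exists>s\<in>{1..t}. R (c, i) s > 0"
    proof (rule ccontr)
      assume "\<not> ?thesis"
      then have "received R t (c, i) \<le> 0"
        unfolding received_def by (intro sum_nonpos) (auto simp: not_less)
      with ge assms(3) show False by linarith
    qed
    then obtain s where s: "1 \<le> s" "s \<le> t" "R (c, i) s > 0" by auto
    have "proc (I ! c ! i') \<le> received R t (c, i')" if "i' < i" for i'
    proof -
      have "completed I (received R (s - 1)) (c, i')"
        using assms(1,2) s that unfolding feasible_def by fast
      then have "proc (I ! c ! i') \<le> received R (s - 1) (c, i')"
        by (auto simp: completed_def)
      also have "\<dots> \<le> received R t (c, i')"
        unfolding received_def
      proof (rule sum_mono2)
        have "(c, i') \<in> job_ids I"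
          using assms(2) that by (auto simp: job_ids_def)
        then show "0 \<le> R (c, i') b" if "b \<in> {1..t} - {1..s - 1}" for b
          using that assms(1) unfolding feasible_def by auto
      qed (use s in auto)
      finally show ?thesis .
    qed
    with ge show "completed I (received R t) (c, i)"
      by (auto simp: completed_def le_less)
  qed (auto simp: completed_def)
  then show ?thesis
    by (simp add: completion_time_def received_def)
qed

text \<open>What is visible of a chain: the number of its completed jobs and the weights of its revealed
  jobs, which are the completed ones and, if there is one, the first uncompleted job.\<close>

type_synonym observation = "(nat \<times> real list) list"

definition num_completed :: "chain_instance \<Rightarrow> (nat \<times> nat \<Rightarrow> real) \<Rightarrow> nat \<Rightarrow> nat" where
  "num_completed I x c = card {i. i < length (I ! c) \<and> completed I x (c, i)}"

definition observe :: "chain_instance \<Rightarrow> (nat \<times> nat \<Rightarrow> real) \<Rightarrow> observation" where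
  "observe I x = map (\<lambda>c. let k = num_completed I x c
                          in (k, map weight (take (Suc k) (I ! c)))) [0..<length I]"

text \<open>For each time step, a non-clairvoyant algorithm maps the predicted chain weights and the list
  of the observations made at times \<open>0, \<dots>, t - 1\<close> to the rates that the first uncompleted jobs of
  the chains receive in time step \<open>t\<close>. Its own earlier rates are a function of these data.\<close>

type_synonym algorithm = "real list \<Rightarrow> observation list \<Rightarrow> nat \<Rightarrow> real"

definition front_rates ::
  "chain_instance \<Rightarrow> (nat \<times> nat \<Rightarrow> real) \<Rightarrow> (nat \<Rightarrow> real) \<Rightarrow> nat \<times> nat \<Rightarrow> real" where
  "front_rates I x r = (\<lambda>(c, i). if i = num_completed I x c then r c else 0)"

text \<open>The state at time \<open>t\<close> consists of the amounts of processing received and the observations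
  made at times \<open>0, \<dots>, t\<close>.\<close>

primrec alg_state ::
  "algorithm \<Rightarrow> real list \<Rightarrow> chain_instance \<Rightarrow> nat \<Rightarrow> (nat \<times> nat \<Rightarrow> real) \<times> observation list" where
  "alg_state A Wh I 0 = ((\<lambda>j. 0), [observe I (\<lambda>j. 0)])"
| "alg_state A Wh I (Suc t) =
     (let (x, h) = alg_state A Wh I t;
          x' = (\<lambda>j. x j + front_rates I x (A Wh h) j)
      in (x', h @ [observe I x']))"

definition alg_schedule :: "algorithm \<Rightarrow> real list \<Rightarrow> chain_instance \<Rightarrow> schedule" where
  "alg_schedule A Wh I j t =
     (case t of 0 \<Rightarrow> 0
      | Suc s \<Rightarrow> (let (x, h) = alg_state A Wh I s in front_rates I x (A Wh h) j))"

lemma received_alg_schedule: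
  "received (alg_schedule A Wh I) t = fst (alg_state A Wh I t)"
  by (induction t) (auto simp: received_def alg_schedule_def fun_eq_iff split_beta Let_def)

definition total_weight :: "job list \<Rightarrow> real" where
  "total_weight ch = (\<Sum>j\<leftarrow>ch. weight j)"

definition total_proc :: "job list \<Rightarrow> real" where
  "total_proc ch = (\<Sum>j\<leftarrow>ch. proc j)"

definition under_chain :: "job list \<Rightarrow> real \<Rightarrow> job list" where
  "under_chain ch wh =
     (let k = (LEAST k. 1 \<le> k \<and> wh \<le> total_weight (take k ch))
      in Job (total_proc (take k ch)) (total_weight (take k ch) - wh) # drop k ch)"

definition over_chain :: "job list \<Rightarrow> real \<Rightarrow> job list" where
  "over_chain ch wh = [Job (total_proc ch) (wh - total_weight ch)]"

definition C_under :: "chain_instance \<Rightarrow> real list \<Rightarrow> chain_instance" where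
  "C_under I Wh = [under_chain ch wh. (ch, wh) \<leftarrow> zip I Wh, wh < total_weight ch]"

definition C_over :: "chain_instance \<Rightarrow> real list \<Rightarrow> chain_instance" where
  "C_over I Wh = [over_chain ch wh. (ch, wh) \<leftarrow> zip I Wh, wh > total_weight ch]"

end

theory Submission
  imports Defs
begin

text \<open>
  Half of the machine is shared equally by the chains; the other half is shared in proportion to the
  predicted remaining weights, each multiplied by a damping factor. The factor of a chain drops by
  \<open>(4/5)^4\<close> in every step in which one of its jobs completes and recovers by \<open>5/4\<close>, up to \<open>1\<close>, in
  every other step. Damping is needed because a job of tiny requirement costs a whole time step:
  otherwise a chain of many such jobs and large overpredicted weight, which is cheap in the
  overpredicted instance, would starve the other chains.

  A chain is damped in at most four full steps per completion, and completions are paid for by the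
  optimum, in which a chain also completes at most one job of positive requirement per step. The
  damped weight present in completing steps is bounded by the initial weight and a fraction of the
  damped weight in full steps, because the total damped weight cannot become negative. In full steps
  any two chains delay each other equally, so every schedule, viewed as a monotone path in the plane
  of the progress of the two chains, pays at least half of their mutual delay. Here the schedule of
  comparison runs an optimum of the instance and one of the overpredicted instance side by side.
  The weight that was not predicted is served by the equal share, at the cost of a factor \<open>\<omega>\<close>.
\<close>

section \<open>Initial segments of chains and sums over their jobs\<close>

text \<open>\<open>completed\<close> refers to all positions up to \<open>i\<close>, so the
  positions counted by \<open>num_completed\<close> form an initial segment, whose size is the first
  position outside it.\<close>

lemma completed_iff_less_num_completed:
  assumes "i < length (I ! c)"
  shows "completed I x (c, i) \<longleftrightarrow> i < num_completed I x c"
proof -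
  let ?S = "{i. i < length (I ! c) \<and> completed I x (c, i)}"
  have fin: "finite ?S" by simp
  have down: "i' \<in> ?S" if "i \<in> ?S" "i' \<le> i" for i i'
    using that by (auto simp: completed_def)
  show ?thesis
  proof
    assume "completed I x (c, i)"
    then have "{..i} \<subseteq> ?S" using down assms by auto
    from card_mono[OF fin this] show "i < num_completed I x c"
      by (simp add: num_completed_def)
  next
    assume less: "i < num_completed I x c"
    show "completed I x (c, i)"
    proof (rule ccontr)
      assume "\<not> ?thesis"
      then have "?S \<subseteq> {..<i}"
        using down by (metis (no_types, lifting) lessThan_iff linorder_not_le mem_Collect_eq subsetI)
      then have "card ?S \<le> i" using card_mono[of "{..<i}" ?S] by simp
      with less show False by (simp add: num_completed_def)
    qed
  qed
qed

lemma sum_job_ids: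
  "(\<Sum>j\<in>job_ids I. g j) = (\<Sum>c<length I. \<Sum>i<length (I ! c). g (c, i))"
  unfolding job_ids_def by (subst sum.Sigma) auto

lemma total_weight_take: "q \<le> length ch \<Longrightarrow> total_weight (take q ch) = (\<Sum>i<q. weight (ch ! i))"
  by (simp add: total_weight_def sum_list_sum_nth atLeast0LessThan)

lemma total_proc_take: "q \<le> length ch \<Longrightarrow> total_proc (take q ch) = (\<Sum>i<q. proc (ch ! i))"
  by (simp add: total_proc_def sum_list_sum_nth atLeast0LessThan)

lemma total_weight_append: "total_weight (xs @ ys) = total_weight xs + total_weight ys"
  by (simp add: total_weight_def)

lemma total_proc_append: "total_proc (xs @ ys) = total_proc xs + total_proc ys"
  by (simp add: total_proc_def)

lemma total_weight_take_drop: "total_weight (take q ch) + total_weight (drop q ch) = total_weight ch"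
  by (metis append_take_drop_id total_weight_append)

text \<open>Writing the remaining weight over all positions with indicators makes its monotonicity
  in \<open>q\<close> evident and lets it be summed over time job by job.\<close>

lemma total_weight_drop:
  "total_weight (drop q ch) = (\<Sum>i<length ch. weight (ch ! i) * of_bool (q \<le> i))"
proof (cases "q \<le> length ch")
  case True
  have "total_weight ch = (\<Sum>i<length ch. weight (ch ! i))"
    using total_weight_take[of "length ch" ch] by simp
  moreover have "total_weight (take q ch) = (\<Sum>i<length ch. weight (ch ! i) * of_bool (\<not> q \<le> i))"
    using True
    by (subst total_weight_take)
       (auto simp: not_le intro!: sum.mono_neutral_cong_left)
  ultimately have "total_weight (drop q ch) =
      (\<Sum>i<length ch. weight (ch ! i) - weight (ch ! i) * of_bool (\<not> q \<le> i))"
    using total_weight_take_drop[of q ch] by (simp add: sum_subtractf)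
  also have "\<dots> = (\<Sum>i<length ch. weight (ch ! i) * of_bool (q \<le> i))"
    by (intro sum.cong) auto
  finally show ?thesis .
next
  case False
  then show ?thesis by (simp add: total_weight_def)
qed

lemma total_proc_take_mono:
  assumes "\<And>j. j \<in> set ch \<Longrightarrow> proc j \<ge> 0" "q \<le> q'"
  shows "total_proc (take q ch) \<le> total_proc (take q' ch)"
proof -
  have "take q' ch = take q ch @ take (q' - q) (drop q ch)"
    using assms(2) by (metis le_add_diff_inverse take_add)
  moreover have "total_proc (take (q' - q) (drop q ch)) \<ge> 0"
    unfolding total_proc_def
    by (rule sum_list_nonneg) (auto dest!: in_set_takeD in_set_dropD intro: assms(1))
  ultimately show ?thesis by (simp add: total_proc_append)
qed

lemma total_weight_nonneg:
  "(\<And>j. j \<in> set ch \<Longrightarrow> weight j \<ge> 0) \<Longrightarrow> total_weight ch \<ge> 0"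
  unfolding total_weight_def by (rule sum_list_nonneg) auto

lemma valid_instanceD:
  assumes "valid_instance I" "c < length I"
  shows "I ! c \<noteq> []" "\<And>j. j \<in> set (I ! c) \<Longrightarrow> proc j \<ge> 0" "\<And>j. j \<in> set (I ! c) \<Longrightarrow> weight j \<ge> 0"
    "\<And>i. i < length (I ! c) \<Longrightarrow> proc (I ! c ! i) \<ge> 0"
    "\<And>i. i < length (I ! c) \<Longrightarrow> weight (I ! c ! i) \<ge> 0"
  using assms unfolding valid_instance_def by (auto dest: nth_mem)

section \<open>Feasible schedules\<close>

text \<open>Feasibility does not forbid giving a job more than its requirement. The cap discards
  this surplus, so that progress measures the position reached in the chain.\<close>

definition progress :: "chain_instance \<Rightarrow> schedule \<Rightarrow> nat \<Rightarrow> nat \<Rightarrow> real" where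
  "progress I R c t = (\<Sum>i<length (I ! c). min (proc (I ! c ! i)) (received R t (c, i)))"

definition residual :: "chain_instance \<Rightarrow> schedule \<Rightarrow> nat \<Rightarrow> nat \<Rightarrow> real" where
  "residual I R c t =
     (\<Sum>i<length (I ! c). weight (I ! c ! i) * of_bool (\<not> completed I (received R t) (c, i)))"

text \<open>This is the weighted completion time of a single chain that has a machine of unit speed
  to itself, without rounding to whole time steps.\<close>

definition load :: "job list \<Rightarrow> real" where
  "load ch = (\<Sum>i<length ch. weight (ch ! i) * total_proc (take (Suc i) ch))"

lemma received_Suc: "received R (Suc t) j = received R t j + R j (Suc t)"
  by (simp add: received_def)

lemma received_0: "received R 0 j = 0"
  by (simp add: received_def)

locale feasible_schedule =
  fixes I :: chain_instance and R :: schedule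
  assumes valid: "valid_instance I" and feas: "feasible I R"
begin

lemma rate_nonneg: "c < length I \<Longrightarrow> i < length (I ! c) \<Longrightarrow> R (c, i) (Suc t) \<ge> 0"
  using feas by (auto simp: feasible_def job_ids_def)

lemma received_mono:
  assumes "c < length I" "i < length (I ! c)" "s \<le> t"
  shows "received R s (c, i) \<le> received R t (c, i)"
  using assms(3)
proof (induction t rule: dec_induct)
  case (step t)
  then show ?case using rate_nonneg[OF assms(1,2), of t] by (simp add: received_Suc)
qed simp

lemma received_nonneg: "c < length I \<Longrightarrow> i < length (I ! c) \<Longrightarrow> received R t (c, i) \<ge> 0"
  using received_mono[of c i 0 t] by (simp add: received_0)

lemma completed_mono:
  assumes "c < length I" "i < length (I ! c)" "s \<le> t" "completed I (received R s) (c, i)"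
  shows "completed I (received R t) (c, i)"
proof -
  have "proc (I ! c ! i') \<le> received R t (c, i')" if "i' \<le> i" for i'
    using assms that received_mono[OF assms(1) _ assms(3), of i'] unfolding completed_def
    by (auto intro: order_trans)
  then show ?thesis by (simp add: completed_def)
qed

lemma completed_completion_time:
  assumes "c < length I" "i < length (I ! c)"
  shows "completed I (received R (completion_time I R (c, i))) (c, i)"
proof -
  have "\<exists>t. completed I (received R t) (c, i)"
    using feas assms by (auto simp: feasible_def job_ids_def)
  then show ?thesis unfolding completion_time_def by (rule LeastI_ex)
qed

lemma not_completed_iff:
  assumes "c < length I" "i < length (I ! c)"
  shows "\<not> completed I (received R t) (c, i) \<longleftrightarrow> t < completion_time I R (c, i)"
proof
  assume "\<not> completed I (received R t) (c, i)"
  then show "t < completion_time I R (c, i)"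
    using completed_mono[OF assms _ completed_completion_time[OF assms], of t] by (meson not_le)
next
  assume "t < completion_time I R (c, i)"
  then show "\<not> completed I (received R t) (c, i)"
    unfolding completion_time_def by (rule not_less_Least)
qed

text \<open>A job with completion time \<open>C\<close> is uncompleted exactly at the times
  \<open>0, ..., C - 1\<close>, so its weight is counted \<open>C\<close> times, or \<open>T\<close>
  times if the sum stops earlier.\<close>

lemma sum_residual:
  assumes "c < length I"
  shows "(\<Sum>t<T. residual I R c t) =
    (\<Sum>i<length (I ! c). weight (I ! c ! i) * real (min T (completion_time I R (c, i))))"
proof -
  have "(\<Sum>t<T. of_bool (\<not> completed I (received R t) (c, i))) =
      real (min T (completion_time I R (c, i)))" if "i < length (I ! c)" for i
  proof -
    have "{..<T} \<inter> {t. t < completion_time I R (c, i)} = {..<min T (completion_time I R (c, i))}"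
      by auto
    then show ?thesis using not_completed_iff[OF assms that] by (simp add: of_bool_def sum.If_cases)
  qed
  then show ?thesis
    unfolding residual_def by (subst sum.swap) (simp add: sum_distrib_left[symmetric])
qed

lemma cost_eq:
  "cost I R = (\<Sum>c<length I. \<Sum>i<length (I ! c). weight (I ! c ! i) * real (completion_time I R (c, i)))"
  unfolding cost_def by (simp add: sum_job_ids)

lemma sum_residual_le_cost: "(\<Sum>t<T. \<Sum>c<length I. residual I R c t) \<le> cost I R"
  unfolding cost_eq
  by (subst sum.swap) (auto simp: sum_residual intro!: sum_mono mult_left_mono valid_instanceD[OF valid])

lemma exists_horizon:
  "\<exists>T. \<forall>c<length I. \<forall>i<length (I ! c). \<forall>t\<ge>T. completed I (received R t) (c, i)"
proof -
  \<comment> \<open>The sum of all completion times is a crude bound on their maximum.\<close>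
  define T where "T = (\<Sum>j\<in>job_ids I. completion_time I R j)"
  have fin: "finite (job_ids I)" by (simp add: job_ids_def)
  have "completion_time I R (c, i) \<le> T" if "c < length I" "i < length (I ! c)" for c i
    unfolding T_def using fin that by (intro member_le_sum) (auto simp: job_ids_def)
  then have "completed I (received R t) (c, i)"
    if "c < length I" "i < length (I ! c)" "T \<le> t" for c i t
    using that not_completed_iff[OF that(1,2), of t] by fastforce
  then show ?thesis by blast
qed

lemma cost_eq_sum_residual:
  assumes "\<forall>c<length I. \<forall>i<length (I ! c). completed I (received R T) (c, i)"
  shows "cost I R = (\<Sum>c<length I. \<Sum>t<T. residual I R c t)"
proof -
  have "min T (completion_time I R (c, i)) = completion_time I R (c, i)"
    if "c < length I" "i < length (I ! c)" for c i
    using assms that not_completed_iff[OF that, of T] by auto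
  then show ?thesis
    unfolding cost_eq by (auto simp: sum_residual intro!: sum.cong)
qed

lemma progress_0: "c < length I \<Longrightarrow> progress I R c 0 = 0"
  unfolding progress_def received_0 by (intro sum.neutral) (auto simp: valid_instanceD[OF valid])

lemma progress_mono: "c < length I \<Longrightarrow> s \<le> t \<Longrightarrow> progress I R c s \<le> progress I R c t"
  unfolding progress_def by (intro sum_mono min.mono received_mono) auto

lemma sum_progress_step_le:
  "(\<Sum>c<length I. progress I R c (Suc t) - progress I R c t) \<le> 1"
proof -
  have "progress I R c (Suc t) - progress I R c t \<le> (\<Sum>i<length (I ! c). R (c, i) (Suc t))"
    if "c < length I" for c
    unfolding progress_def sum_subtractf[symmetric]
  proof (rule sum_mono)
    fix i assume "i \<in> {..<length (I ! c)}"
    then show "min (proc (I ! c ! i)) (received R (Suc t) (c, i)) -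
        min (proc (I ! c ! i)) (received R t (c, i)) \<le> R (c, i) (Suc t)"
      using rate_nonneg[OF that, of i t] by (simp add: received_Suc min_def)
  qed
  then have "(\<Sum>c<length I. progress I R c (Suc t) - progress I R c t)
      \<le> (\<Sum>c<length I. \<Sum>i<length (I ! c). R (c, i) (Suc t))" by (intro sum_mono) auto
  also have "\<dots> = (\<Sum>j\<in>job_ids I. R j (Suc t))" by (simp add: sum_job_ids)
  also have "\<dots> \<le> 1" using feas by (auto simp: feasible_def)
  finally show ?thesis .
qed

lemma progress_le_time:
  assumes "c < length I" shows "progress I R c t \<le> real t"
proof (induction t)
  case (Suc t)
  have "progress I R c (Suc t) - progress I R c t \<le> (\<Sum>c<length I. progress I R c (Suc t) - progress I R c t)"
    using assms progress_mono[of _ t "Suc t"] by (intro member_le_sum) auto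
  with Suc sum_progress_step_le[of t] show ?case by simp
qed (simp add: progress_0 assms)

lemma completed_progress:
  assumes "c < length I" "i < length (I ! c)" "completed I (received R t) (c, i)"
  shows "total_proc (take (Suc i) (I ! c)) \<le> progress I R c t"
proof -
  have "total_proc (take (Suc i) (I ! c)) = (\<Sum>i'<Suc i. proc (I ! c ! i'))"
    using assms by (intro total_proc_take) auto
  also have "\<dots> = (\<Sum>i'<Suc i. min (proc (I ! c ! i')) (received R t (c, i')))"
    using assms(3) by (intro sum.cong) (auto simp: completed_def less_Suc_eq_le)
  also have "\<dots> \<le> progress I R c t"
    unfolding progress_def using assms
    by (intro sum_mono2) (auto simp: received_nonneg valid_instanceD[OF valid])
  finally show ?thesis .
qed

text \<open>When a job completes, the whole prefix of its chain has been processed, and progress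
  cannot exceed the elapsed time. This holds in all chains at once.\<close>

lemma load_le_cost: "(\<Sum>c<length I. load (I ! c)) \<le> cost I R"
proof -
  have "total_proc (take (Suc i) (I ! c)) \<le> real (completion_time I R (c, i))"
    if "c < length I" "i < length (I ! c)" for c i
    using completed_progress[OF that completed_completion_time[OF that]] progress_le_time that
    by (meson order_trans)
  then show ?thesis
    unfolding cost_eq load_def
    by (intro sum_mono mult_left_mono) (auto simp: valid_instanceD[OF valid])
qed

text \<open>A successor may run only from the step after the completion of its predecessors. Hence
  each step completes at most one job of positive requirement per chain. This lower bound on every
  schedule later pays for the steps in which the algorithm completes a job.\<close>

lemma card_positive_le_time:
  assumes "c < length I"
  shows "i < length (I ! c) \<Longrightarrow> completed I (received R t) (c, i) \<Longrightarrow>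
    card {i'. i' \<le> i \<and> proc (I ! c ! i') > 0} \<le> t"
proof (induction t arbitrary: i)
  case 0
  then have "{i'. i' \<le> i \<and> proc (I ! c ! i') > 0} = {}"
    by (auto simp: completed_def received_0 not_less)
  then show ?case by simp
next
  case (Suc t)
  let ?P = "\<lambda>i. {i'. i' \<le> i \<and> proc (I ! c ! i') > 0}"
  define k where "k = num_completed I (received R t) c"
  show ?case
  proof (cases "i < k")
    case True
    then have "completed I (received R t) (c, i)"
      using completed_iff_less_num_completed[OF Suc.prems(1)] by (simp add: k_def)
    then show ?thesis using Suc.IH[OF Suc.prems(1)] by simp
  next
    case False
    \<comment> \<open>The job \<open>k\<close> is uncompleted at time \<open>t\<close>, so nothing
      behind it has run up to and including step \<open>Suc t\<close>. Jobs behind it that are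
      nevertheless completed then have requirement 0.\<close>
    have later: "proc (I ! c ! i') \<le> 0" if "k < i'" "i' \<le> i" for i'
    proof -
      have i': "i' < length (I ! c)" "k < length (I ! c)" using that Suc.prems by auto
      have nk: "\<not> completed I (received R t) (c, k)"
        using completed_iff_less_num_completed[OF i'(2)] by (simp add: k_def)
      have "R (c, i') s = 0" if "s \<in> {1..Suc t}" for s
      proof (rule ccontr)
        assume "R (c, i') s \<noteq> 0"
        with rate_nonneg[OF assms i'(1), of "s - 1"] that have "R (c, i') s > 0" by auto
        then have "completed I (received R (s - 1)) (c, k)"
          using feas[unfolded feasible_def] assms i' that \<open>k < i'\<close>
          by (auto simp: job_ids_def)
        then have "completed I (received R t) (c, k)"
          using completed_mono[OF assms i'(2), of "s - 1" t] that by auto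
        with nk show False by simp
      qed
      then have "received R (Suc t) (c, i') = 0" by (simp add: received_def)
      moreover have "received R (Suc t) (c, i') \<ge> proc (I ! c ! i')"
        using Suc.prems(2) that by (auto simp: completed_def)
      ultimately show ?thesis by simp
    qed
    have sub: "?P i \<subseteq> insert k {i'. i' < k \<and> proc (I ! c ! i') > 0}"
      using later by (auto simp: not_less[symmetric] intro: linorder_cases)
    have "card {i'. i' < k \<and> proc (I ! c ! i') > 0} \<le> t"
    proof (cases k)
      case (Suc k')
      have "k' < length (I ! c)" using Suc False Suc.prems(1) by auto
      then have "completed I (received R t) (c, k')"
        using completed_iff_less_num_completed[of k' I c] Suc by (simp add: k_def)
      from Suc.IH[OF \<open>k' < _\<close> this] show ?thesis by (simp add: Suc less_Suc_eq_le)
    qed simp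
    moreover have "card (?P i) \<le> Suc (card {i'. i' < k \<and> proc (I ! c ! i') > 0})"
      using card_mono[OF _ sub] by (simp add: card_insert_if split: if_splits)
    ultimately show ?thesis by simp
  qed
qed

end

section \<open>Comparing two monotone paths\<close>

text \<open>For ordered endpoints this is the length of the intersection of the intervals from
  \<open>a\<close> to \<open>b\<close> and from \<open>lo\<close> to \<open>hi\<close>. As a
  difference of two clamped values it telescopes along a path.\<close>

definition overlap :: "real \<Rightarrow> real \<Rightarrow> real \<Rightarrow> real \<Rightarrow> real" where
  "overlap a b lo hi = min hi (max lo b) - min hi (max lo a)"

lemma overlap_commute: "a \<le> b \<Longrightarrow> lo \<le> hi \<Longrightarrow> overlap a b lo hi = overlap lo hi a b"
  unfolding overlap_def min_def max_def by auto

lemma overlap_nonneg: "a \<le> b \<Longrightarrow> overlap a b lo hi \<ge> 0"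
  unfolding overlap_def min_def max_def by auto

lemma sum_overlap:
  fixes z :: "nat \<Rightarrow> real"
  shows "(\<Sum>s<T. overlap (z s) (z (Suc s)) lo hi) = overlap (z 0) (z T) lo hi"
  unfolding overlap_def by (subst sum_lessThan_telescope) simp

lemma overlap_le: "lo \<le> hi \<Longrightarrow> overlap a b lo hi \<le> hi - lo"
  unfolding overlap_def min_def max_def by auto

text \<open>At the moment when the path \<open>z\<close> leaves the rectangle spanned by the step \<open>t\<close> of the path
  \<open>Y\<close>, one of its two coordinates has not yet passed the end of that step, so the other coordinate
  traverses its side of the rectangle while the first one still carries the full weight.\<close>

lemma path_step_le:
  fixes z\<^sub>1 z\<^sub>2 :: "nat \<Rightarrow> real"
  assumes mono: "mono z\<^sub>1" "mono z\<^sub>2"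
    and start: "z\<^sub>1 0 \<le> a\<^sub>1" "z\<^sub>2 0 \<le> a\<^sub>2" and "end": "b\<^sub>1 \<le> z\<^sub>1 T" "b\<^sub>2 \<le> z\<^sub>2 T"
    and ab: "a\<^sub>1 \<le> b\<^sub>1" "a\<^sub>2 \<le> b\<^sub>2"
    and F: "\<And>x. x < b\<^sub>1 \<Longrightarrow> d\<^sub>1 \<le> F\<^sub>1 x" "\<And>x. x < b\<^sub>2 \<Longrightarrow> d\<^sub>2 \<le> F\<^sub>2 x"
    and F_nonneg: "\<And>x. F\<^sub>1 x \<ge> 0" "\<And>x. F\<^sub>2 x \<ge> 0"
    and q: "q \<le> d\<^sub>1 * (b\<^sub>2 - a\<^sub>2)" "q \<le> d\<^sub>2 * (b\<^sub>1 - a\<^sub>1)"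
  shows "q \<le> (\<Sum>s<T. F\<^sub>1 (z\<^sub>1 s) * overlap (z\<^sub>2 s) (z\<^sub>2 (Suc s)) a\<^sub>2 b\<^sub>2) +
             (\<Sum>s<T. F\<^sub>2 (z\<^sub>2 s) * overlap (z\<^sub>1 s) (z\<^sub>1 (Suc s)) a\<^sub>1 b\<^sub>1)"
proof -
  \<comment> \<open>Up to time \<open>S\<close> the coordinate \<open>z\<close> stays below
    \<open>b\<close>, so \<open>F\<close> is at least \<open>d\<close> there, while
    \<open>z'\<close> traverses the whole side from \<open>a'\<close> to \<open>b'\<close>.\<close>
  have side: "d * (b' - a') \<le> (\<Sum>s<T. F (z s) * overlap (z' s) (z' (Suc s)) a' b')"
    if S: "S \<le> T" "b' \<le> z' S" "\<And>s. s < S \<Longrightarrow> z s < b"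
      and F: "\<And>x. x < b \<Longrightarrow> d \<le> F x" "\<And>x. F x \<ge> 0" and z': "mono z'" "z' 0 \<le> a'" and ab: "a' \<le> b'"
    for F :: "real \<Rightarrow> real" and d a' b' b z z' and S :: nat
  proof -
    have nn: "overlap (z' s) (z' (Suc s)) a' b' \<ge> 0" for s
      using z' by (intro overlap_nonneg) (auto simp: mono_def)
    have "d * (b' - a') = d * (\<Sum>s<S. overlap (z' s) (z' (Suc s)) a' b')"
      unfolding sum_overlap using S(2) z'(2) ab by (simp add: overlap_def)
    also have "\<dots> \<le> (\<Sum>s<S. F (z s) * overlap (z' s) (z' (Suc s)) a' b')"
      unfolding sum_distrib_left using S F nn by (intro sum_mono mult_right_mono) auto
    also have "\<dots> \<le> (\<Sum>s<T. F (z s) * overlap (z' s) (z' (Suc s)) a' b')"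
      using S F nn by (intro sum_mono2) auto
    finally show ?thesis .
  qed
  define S\<^sub>1 where "S\<^sub>1 = (LEAST s. b\<^sub>1 \<le> z\<^sub>1 s)"
  define S\<^sub>2 where "S\<^sub>2 = (LEAST s. b\<^sub>2 \<le> z\<^sub>2 s)"
  have S\<^sub>1: "b\<^sub>1 \<le> z\<^sub>1 S\<^sub>1" "S\<^sub>1 \<le> T" "\<And>s. s < S\<^sub>1 \<Longrightarrow> z\<^sub>1 s < b\<^sub>1"
    unfolding S\<^sub>1_def using "end"(1) by (auto intro: LeastI Least_le dest: not_less_Least)
  have S\<^sub>2: "b\<^sub>2 \<le> z\<^sub>2 S\<^sub>2" "S\<^sub>2 \<le> T" "\<And>s. s < S\<^sub>2 \<Longrightarrow> z\<^sub>2 s < b\<^sub>2"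
    unfolding S\<^sub>2_def using "end"(2) by (auto intro: LeastI Least_le dest: not_less_Least)
  have nonneg: "(\<Sum>s<T. F\<^sub>1 (z\<^sub>1 s) * overlap (z\<^sub>2 s) (z\<^sub>2 (Suc s)) a\<^sub>2 b\<^sub>2) \<ge> 0"
     "(\<Sum>s<T. F\<^sub>2 (z\<^sub>2 s) * overlap (z\<^sub>1 s) (z\<^sub>1 (Suc s)) a\<^sub>1 b\<^sub>1) \<ge> 0"
    using mono by (auto intro!: sum_nonneg mult_nonneg_nonneg overlap_nonneg F_nonneg simp: mono_def)
  show ?thesis
  \<comment> \<open>The coordinate that reaches its end first traverses its side while the other one
    is still before its own end. Since \<open>q\<close> is bounded by both products, either order
    suffices.\<close>
  proof (cases "S\<^sub>2 \<le> S\<^sub>1")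
    case True
    have "d\<^sub>1 * (b\<^sub>2 - a\<^sub>2) \<le> (\<Sum>s<T. F\<^sub>1 (z\<^sub>1 s) * overlap (z\<^sub>2 s) (z\<^sub>2 (Suc s)) a\<^sub>2 b\<^sub>2)"
      by (rule side[of S\<^sub>2 b\<^sub>2 z\<^sub>2 z\<^sub>1 b\<^sub>1]) (use S\<^sub>1 S\<^sub>2 True F F_nonneg mono start ab in auto)
    then show ?thesis using q(1) nonneg(2) by linarith
  next
    case False
    have "d\<^sub>2 * (b\<^sub>1 - a\<^sub>1) \<le> (\<Sum>s<T. F\<^sub>2 (z\<^sub>2 s) * overlap (z\<^sub>1 s) (z\<^sub>1 (Suc s)) a\<^sub>1 b\<^sub>1)"
      by (rule side[of S\<^sub>1 b\<^sub>1 z\<^sub>1 z\<^sub>2 b\<^sub>2]) (use S\<^sub>1 S\<^sub>2 False F F_nonneg mono start ab in auto)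
    then show ?thesis using q(2) nonneg(1) by linarith
  qed
qed

text \<open>The steps of \<open>Y\<close> cover intervals without common interior. By symmetry of
  \<open>overlap\<close>, the clamping can be moved to \<open>Y\<close>, where the sum
  telescopes.\<close>

lemma sum_overlap_le:
  fixes Y :: "nat \<Rightarrow> real"
  assumes "mono Y" "a \<le> b" "B \<subseteq> {..<N}"
  shows "(\<Sum>t\<in>B. overlap a b (Y t) (Y (Suc t))) \<le> b - a"
proof -
  have Y: "Y t \<le> Y (Suc t)" "Y 0 \<le> Y N" for t using assms by (auto simp: mono_def)
  have "(\<Sum>t\<in>B. overlap a b (Y t) (Y (Suc t))) \<le> (\<Sum>t<N. overlap a b (Y t) (Y (Suc t)))"
    using assms by (intro sum_mono2 overlap_nonneg) auto
  also have "\<dots> = (\<Sum>t<N. overlap (Y t) (Y (Suc t)) a b)"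
    by (intro sum.cong overlap_commute assms Y) auto
  also have "\<dots> \<le> b - a" unfolding sum_overlap using assms(2) by (rule overlap_le)
  finally show ?thesis .
qed

text \<open>The rectangle bounds are summed over the steps of \<open>Y\<close>. No part of a step of
  \<open>z\<close> is charged twice, since the sides of the rectangles do not overlap in either
  coordinate. With \<open>F\<close> as weight, the right-hand side is the delay that the two
  coordinates cause each other along \<open>z\<close>.\<close>

lemma path_le:
  fixes Y\<^sub>1 Y\<^sub>2 z\<^sub>1 z\<^sub>2 d\<^sub>1 d\<^sub>2 q :: "nat \<Rightarrow> real"
  assumes mono: "mono z\<^sub>1" "mono z\<^sub>2" "mono Y\<^sub>1" "mono Y\<^sub>2"
    and start: "z\<^sub>1 0 \<le> Y\<^sub>1 0" "z\<^sub>2 0 \<le> Y\<^sub>2 0" and "end": "Y\<^sub>1 N \<le> z\<^sub>1 T" "Y\<^sub>2 N \<le> z\<^sub>2 T"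
    and F: "\<And>t x. t \<in> B \<Longrightarrow> x < Y\<^sub>1 (Suc t) \<Longrightarrow> d\<^sub>1 t \<le> F\<^sub>1 x"
           "\<And>t x. t \<in> B \<Longrightarrow> x < Y\<^sub>2 (Suc t) \<Longrightarrow> d\<^sub>2 t \<le> F\<^sub>2 x"
    and F_nonneg: "\<And>x. F\<^sub>1 x \<ge> 0" "\<And>x. F\<^sub>2 x \<ge> 0"
    and B: "B \<subseteq> {..<N}"
    and q: "\<And>t. t \<in> B \<Longrightarrow> q t \<le> d\<^sub>1 t * (Y\<^sub>2 (Suc t) - Y\<^sub>2 t)"
           "\<And>t. t \<in> B \<Longrightarrow> q t \<le> d\<^sub>2 t * (Y\<^sub>1 (Suc t) - Y\<^sub>1 t)"
  shows "(\<Sum>t\<in>B. q t) \<le> (\<Sum>s<T. F\<^sub>1 (z\<^sub>1 s) * (z\<^sub>2 (Suc s) - z\<^sub>2 s)) +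
                        (\<Sum>s<T. F\<^sub>2 (z\<^sub>2 s) * (z\<^sub>1 (Suc s) - z\<^sub>1 s))"
proof -
  have part: "(\<Sum>t\<in>B. \<Sum>s<T. F (z s) * overlap (z' s) (z' (Suc s)) (Y t) (Y (Suc t)))
      \<le> (\<Sum>s<T. F (z s) * (z' (Suc s) - z' s))"
    if "mono z'" "mono Y" "\<And>x. F x \<ge> 0" for F :: "real \<Rightarrow> real" and z z' Y :: "nat \<Rightarrow> real"
    using that B
    by (subst sum.swap, unfold sum_distrib_left[symmetric])
       (auto intro!: sum_mono mult_left_mono sum_overlap_le simp: mono_def)
  have "(\<Sum>t\<in>B. q t) \<le>
      (\<Sum>t\<in>B. (\<Sum>s<T. F\<^sub>1 (z\<^sub>1 s) * overlap (z\<^sub>2 s) (z\<^sub>2 (Suc s)) (Y\<^sub>2 t) (Y\<^sub>2 (Suc t))) +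
             (\<Sum>s<T. F\<^sub>2 (z\<^sub>2 s) * overlap (z\<^sub>1 s) (z\<^sub>1 (Suc s)) (Y\<^sub>1 t) (Y\<^sub>1 (Suc t))))"
  proof (rule sum_mono)
    fix t assume t: "t \<in> B"
    with B have "Suc t \<le> N" by auto
    have "z\<^sub>1 0 \<le> Y\<^sub>1 t" "z\<^sub>2 0 \<le> Y\<^sub>2 t"
      using start monoD[OF mono(3), of 0 t] monoD[OF mono(4), of 0 t] by auto
    moreover have "Y\<^sub>1 (Suc t) \<le> z\<^sub>1 T" "Y\<^sub>2 (Suc t) \<le> z\<^sub>2 T"
      using "end" monoD[OF mono(3) \<open>Suc t \<le> N\<close>] monoD[OF mono(4) \<open>Suc t \<le> N\<close>] by auto
    moreover have "Y\<^sub>1 t \<le> Y\<^sub>1 (Suc t)" "Y\<^sub>2 t \<le> Y\<^sub>2 (Suc t)"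
      using mono by (auto simp: mono_def)
    ultimately show "q t \<le> (\<Sum>s<T. F\<^sub>1 (z\<^sub>1 s) * overlap (z\<^sub>2 s) (z\<^sub>2 (Suc s)) (Y\<^sub>2 t) (Y\<^sub>2 (Suc t))) +
             (\<Sum>s<T. F\<^sub>2 (z\<^sub>2 s) * overlap (z\<^sub>1 s) (z\<^sub>1 (Suc s)) (Y\<^sub>1 t) (Y\<^sub>1 (Suc t)))"
      by (rule path_step_le[OF mono(1,2) _ _ _ _ _ _ F(1)[OF t] F(2)[OF t] F_nonneg q(1)[OF t] q(2)[OF t]])
  qed
  also have "\<dots> \<le> (\<Sum>s<T. F\<^sub>1 (z\<^sub>1 s) * (z\<^sub>2 (Suc s) - z\<^sub>2 s)) +
                  (\<Sum>s<T. F\<^sub>2 (z\<^sub>2 s) * (z\<^sub>1 (Suc s) - z\<^sub>1 s))"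
    unfolding sum.distrib by (intro add_mono part mono F_nonneg)
  finally show ?thesis .
qed

section \<open>The algorithm\<close>

text \<open>The argument lists the numbers of completed jobs of a chain at all past times, latest first.\<close>

fun penalty :: "nat list \<Rightarrow> nat" where
  "penalty (k # k' # ks) = (if k = k' then penalty (k' # ks) - 1 else penalty (k' # ks) + 4)"
| "penalty _ = 0"

text \<open>The revealed weights number \<open>k + 1\<close> as long as the chain has an uncompleted
  job and \<open>k\<close> afterwards. The test therefore recognizes the end of the chain, whose
  length is hidden from the algorithm.\<close>

definition claim :: "real list \<Rightarrow> observation \<Rightarrow> nat \<Rightarrow> real" where
  "claim Wh obs c =
     (case obs ! c of (k, ws) \<Rightarrow> if k < length ws then max 0 (Wh ! c - sum_list (take k ws)) else 0)"

definition damped_claim :: "real list \<Rightarrow> observation list \<Rightarrow> nat \<Rightarrow> real" where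
  "damped_claim Wh h c = claim Wh (last h) c * (4/5) ^ penalty (map (\<lambda>obs. fst (obs ! c)) (rev h))"

text \<open>If all damped claims vanish, the second summand is \<open>0 / 0 = 0\<close> and its half
  of the machine stays idle. Shares of chains without an uncompleted job are lost.\<close>

definition damped_rr :: algorithm where
  "damped_rr Wh h c = 1 / (2 * real (length Wh)) +
     damped_claim Wh h c / (2 * (\<Sum>c'<length Wh. damped_claim Wh h c'))"

section \<open>The run of the algorithm\<close>

locale damped_run =
  fixes I :: chain_instance and Wh :: "real list"
  assumes valid: "valid_instance I" and len: "length Wh = length I"
begin

abbreviation "sched \<equiv> alg_schedule damped_rr Wh I"
abbreviation "n \<equiv> length I"

definition finished :: "nat \<Rightarrow> nat \<Rightarrow> nat" where
  "finished c t = num_completed I (received sched t) c"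

definition pen :: "nat \<Rightarrow> nat \<Rightarrow> nat" where
  "pen c t = penalty (map (\<lambda>obs. fst (obs ! c)) (rev (snd (alg_state damped_rr Wh I t))))"

text \<open>From here on the data of the algorithm are functions of chain and time. This one
  corresponds to \<open>claim\<close>, and \<open>dclaim\<close> to \<open>damped_claim\<close>,
  with the history eliminated.\<close>

definition pclaim :: "nat \<Rightarrow> nat \<Rightarrow> real" where
  "pclaim c t = (if finished c t < length (I ! c)
     then max 0 (Wh ! c - total_weight (take (finished c t) (I ! c))) else 0)"

definition dclaim :: "nat \<Rightarrow> nat \<Rightarrow> real" where
  "dclaim c t = pclaim c t * (4/5) ^ pen c t"

definition total_claim :: "nat \<Rightarrow> real" where
  "total_claim t = (\<Sum>c<n. dclaim c t)"

definition rate :: "nat \<Rightarrow> nat \<Rightarrow> real" where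
  "rate c t = 1 / (2 * real n) + dclaim c t / (2 * total_claim t)"

lemma last_history: "\<exists>hs. snd (alg_state damped_rr Wh I t) = hs @ [observe I (received sched t)]"
  by (cases t) (auto simp: received_alg_schedule received_0 split_beta Let_def)

lemma history_Suc:
  "snd (alg_state damped_rr Wh I (Suc t)) = snd (alg_state damped_rr Wh I t) @ [observe I (received sched (Suc t))]"
  unfolding received_alg_schedule by (simp add: split_beta Let_def)

lemma observe_nth: "c < n \<Longrightarrow> observe I x ! c = (num_completed I x c, map weight (take (Suc (num_completed I x c)) (I ! c)))"
  by (simp add: observe_def Let_def)

lemma pen_0: "pen c 0 = 0"
  by (simp add: pen_def)

lemma pen_Suc:
  assumes "c < n"
  shows "pen c (Suc t) = (if finished c (Suc t) = finished c t then pen c t - 1 else pen c t + 4)"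
proof -
  obtain hs where "snd (alg_state damped_rr Wh I t) = hs @ [observe I (received sched t)]"
    using last_history by blast
  then show ?thesis
    unfolding pen_def history_Suc finished_def by (simp add: observe_nth assms)
qed

lemma damped_claim_eq:
  assumes "c < n"
  shows "damped_claim Wh (snd (alg_state damped_rr Wh I t)) c = dclaim c t"
proof -
  obtain hs where hs: "snd (alg_state damped_rr Wh I t) = hs @ [observe I (received sched t)]"
    using last_history by blast
  have "claim Wh (observe I (received sched t)) c = pclaim c t"
    unfolding claim_def observe_nth[OF assms] pclaim_def finished_def
    by (auto simp: take_map min_def total_weight_def)
  then show ?thesis
    unfolding damped_claim_def dclaim_def pen_def by (simp add: hs)
qed

lemma sched_Suc:
  assumes "c < n"
  shows "sched (c, i) (Suc t) = (if i = finished c t then rate c t else 0)"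
proof -
  have "damped_rr Wh (snd (alg_state damped_rr Wh I t)) c = rate c t"
    unfolding damped_rr_def[of Wh "snd (alg_state damped_rr Wh I t)"] rate_def total_claim_def
    using assms by (simp add: damped_claim_eq len)
  then show ?thesis
    by (simp add: alg_schedule_def split_beta Let_def front_rates_def finished_def received_alg_schedule)
qed

lemma pclaim_nonneg: "pclaim c t \<ge> 0"
  by (simp add: pclaim_def)

lemma dclaim_nonneg: "dclaim c t \<ge> 0"
  by (simp add: dclaim_def pclaim_nonneg)

lemma dclaim_le_pclaim: "dclaim c t \<le> pclaim c t"
  unfolding dclaim_def using pclaim_nonneg[of c t] by (simp add: mult_left_le power_le_one)

lemma total_claim_nonneg: "total_claim t \<ge> 0"
  unfolding total_claim_def by (intro sum_nonneg dclaim_nonneg)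

lemma rate_ge: "rate c t \<ge> 1 / (2 * real n)" "rate c t \<ge> dclaim c t / (2 * total_claim t)"
  unfolding rate_def using dclaim_nonneg[of c t] total_claim_nonneg[of t] by auto

lemma rate_nonneg: "rate c t \<ge> 0"
  using rate_ge(1)[of c t] by (meson order_trans divide_nonneg_nonneg zero_le_one of_nat_0_le_iff mult_nonneg_nonneg zero_le_numeral)

lemma sum_rate_le: "(\<Sum>c<n. rate c t) \<le> 1"
proof -
  have "(\<Sum>c<n. rate c t) = (\<Sum>c<n. 1 / (2 * real n)) + total_claim t / (2 * total_claim t)"
    unfolding rate_def sum.distrib by (simp add: total_claim_def sum_divide_distrib)
  \<comment> \<open>Equality fails only when a denominator is 0, and then the corresponding half is
    0.\<close>
  also have "\<dots> \<le> 1/2 + 1/2"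
    by (intro add_mono) (auto simp: field_simps)
  finally show ?thesis by simp
qed

lemma received_sched_Suc:
  "c < n \<Longrightarrow> received sched (Suc t) (c, i) =
    received sched t (c, i) + (if i = finished c t then rate c t else 0)"
  by (simp add: received_Suc sched_Suc)

lemma received_sched_nonneg: "c < n \<Longrightarrow> received sched t (c, i) \<ge> 0"
  by (induction t) (auto simp: received_0 received_sched_Suc rate_nonneg)

lemma received_sched_mono: "c < n \<Longrightarrow> s \<le> t \<Longrightarrow> received sched s (c, i) \<le> received sched t (c, i)"
proof -
  assume "c < n" "s \<le> t"
  from \<open>s \<le> t\<close> show ?thesis
    by (induction rule: dec_induct) (use \<open>c < n\<close> rate_nonneg[of c] in \<open>auto simp: received_sched_Suc intro: order_trans\<close>)
qed

lemma completed_iff_less_finished: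
  "i < length (I ! c) \<Longrightarrow> completed I (received sched t) (c, i) \<longleftrightarrow> i < finished c t"
  by (simp add: completed_iff_less_num_completed finished_def)

lemma finished_mono: assumes "c < n" "s \<le> t" shows "finished c s \<le> finished c t"
proof -
  have "{i. i < length (I ! c) \<and> completed I (received sched s) (c, i)}
      \<subseteq> {i. i < length (I ! c) \<and> completed I (received sched t) (c, i)}"
    using received_sched_mono[OF assms] by (auto simp: completed_def intro: order_trans)
  then show ?thesis unfolding finished_def num_completed_def by (intro card_mono) auto
qed

lemma received_beyond_front:
  assumes "c < n" shows "finished c t < i \<Longrightarrow> received sched t (c, i) = 0"
proof (induction t)
  case (Suc t)
  then show ?case using finished_mono[OF assms, of t "Suc t"] by (auto simp: received_sched_Suc assms)
qed (simp add: received_0)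

text \<open>All predecessors of the front job are completed, so only its own requirement can be
  missing. In particular a front job always has positive requirement.\<close>

lemma received_front_less:
  assumes "c < n" "finished c t < length (I ! c)"
  shows "received sched t (c, finished c t) < proc (I ! c ! finished c t)"
proof (rule ccontr)
  assume "\<not> ?thesis"
  moreover have "received sched t (c, i) \<ge> proc (I ! c ! i)" if "i < finished c t" for i
    using completed_iff_less_finished[of i c t] that assms by (auto simp: completed_def)
  ultimately have "completed I (received sched t) (c, finished c t)"
    by (auto simp: completed_def le_less)
  then show False using completed_iff_less_finished[OF assms(2)] by simp
qed

abbreviation "prog \<equiv> progress I sched"

lemma prog_mono: "c < n \<Longrightarrow> s \<le> t \<Longrightarrow> prog c s \<le> prog c t"
  unfolding progress_def by (intro sum_mono min.mono received_sched_mono) auto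

lemma prog_0: "c < n \<Longrightarrow> prog c 0 = 0"
  unfolding progress_def received_0 by (intro sum.neutral) (auto simp: valid_instanceD[OF valid])

lemma prog_le:
  assumes "c < n" "finished c t < q" "q \<le> length (I ! c)"
  shows "prog c t \<le> total_proc (take q (I ! c))"
proof -
  have "prog c t = (\<Sum>i<q. min (proc (I ! c ! i)) (received sched t (c, i)))"
    unfolding progress_def using assms received_beyond_front[OF assms(1), of t]
    by (intro sum.mono_neutral_right) (auto simp: valid_instanceD[OF valid])
  also have "\<dots> \<le> (\<Sum>i<q. proc (I ! c ! i))" by (intro sum_mono) auto
  finally show ?thesis using assms by (simp add: total_proc_take)
qed

lemma prog_le_total: "c < n \<Longrightarrow> prog c t \<le> total_proc (I ! c)"
  using total_proc_take[of "length (I ! c)" "I ! c"]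
  unfolding progress_def by (simp add: sum_mono)

text \<open>The front job is uncompleted at both ends of the step, so the cap in
  \<open>progress\<close> cuts nothing off and the entire rate counts.\<close>

lemma prog_full_step:
  assumes "c < n" "finished c t < length (I ! c)" "finished c (Suc t) = finished c t"
  shows "prog c (Suc t) - prog c t = rate c t"
proof -
  let ?k = "finished c t"
  have "prog c (Suc t) - prog c t = (\<Sum>i<length (I ! c). if i = ?k then rate c t else 0)"
    unfolding progress_def sum_subtractf[symmetric]
  proof (rule sum.cong)
    fix i assume "i \<in> {..<length (I ! c)}"
    show "min (proc (I ! c ! i)) (received sched (Suc t) (c, i)) - min (proc (I ! c ! i)) (received sched t (c, i))
        = (if i = ?k then rate c t else 0)"
      using received_front_less[OF assms(1), of "Suc t"] received_front_less[OF assms(1,2)] assms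
      by (auto simp: received_sched_Suc)
  qed simp
  then show ?thesis using assms by simp
qed

section \<open>Counting full and wasted steps, and feasibility\<close>

text \<open>In a full step, one that completes no job of the chain, the equal share alone advances
  the chain by \<open>1 / (2 * real n)\<close>.\<close>

lemma full_steps_le:
  assumes "c < n" "q \<le> length (I ! c)"
  shows "real (card {t. t < N \<and> finished c (Suc t) = finished c t \<and> finished c t < q})
      \<le> 2 * real n * total_proc (take q (I ! c))"
proof -
  let ?S = "\<lambda>N. {t. t < N \<and> finished c (Suc t) = finished c t \<and> finished c t < q}"
  \<comment> \<open>Counting needs the comparison with \<open>prog\<close>, which may later outgrow
    the prefix. The second bound is therefore carried along from the last counted step.\<close>
  have "real (card (?S N)) / (2 * real n) \<le> min (prog c N) (total_proc (take q (I ! c)))"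
  proof (induction N)
    case 0
    then show ?case using assms total_proc_take_mono[of "I ! c" 0 q]
      by (simp add: prog_0 total_proc_def valid_instanceD[OF valid])
  next
    case (Suc N)
    show ?case
    proof (cases "finished c (Suc N) = finished c N \<and> finished c N < q")
      case True
      then have "?S (Suc N) = insert N (?S N)" by (auto simp: less_Suc_eq)
      then have "real (card (?S (Suc N))) / (2 * real n) = real (card (?S N)) / (2 * real n) + 1 / (2 * real n)"
        by (simp add: add_divide_distrib)
      moreover have "prog c (Suc N) - prog c N = rate c N"
        using True assms by (intro prog_full_step) auto
      moreover have "prog c (Suc N) \<le> total_proc (take q (I ! c))"
        using True assms by (intro prog_le) auto
      ultimately show ?thesis using Suc rate_ge(1)[of c N] by simp
    next
      case False
      then have "?S (Suc N) = ?S N" by (auto simp: less_Suc_eq)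
      then show ?thesis using Suc prog_mono[OF assms(1), of N "Suc N"] by auto
    qed
  qed
  then have "real (card (?S N)) / (2 * real n) \<le> total_proc (take q (I ! c))" by simp
  moreover have "2 * real n > 0" using assms by linarith
  ultimately show ?thesis by (simp only: pos_divide_le_eq mult.commute)
qed

text \<open>A step that completes a job of the chain is mapped to the front job at its beginning.
  The front moves in such a step, so the map is injective, and front jobs have positive
  requirement.\<close>

lemma waste_steps_le:
  assumes "c < n" "i < length (I ! c)"
  shows "card {t. t < N \<and> finished c (Suc t) \<noteq> finished c t \<and> finished c t \<le> i}
      \<le> card {i'. i' \<le> i \<and> proc (I ! c ! i') > 0}"
proof (rule card_inj_on_le)
  let ?S = "{t. t < N \<and> finished c (Suc t) \<noteq> finished c t \<and> finished c t \<le> i}"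
  show "inj_on (finished c) ?S"
  proof (rule linorder_inj_onI)
    fix s t assume "s < t" "s \<in> ?S" "t \<in> ?S"
    then show "finished c s \<noteq> finished c t"
      using finished_mono[OF assms(1), of s "Suc s"] finished_mono[OF assms(1), of "Suc s" t] by auto
  qed auto
  show "finished c ` ?S \<subseteq> {i'. i' \<le> i \<and> proc (I ! c ! i') > 0}"
  proof (clarsimp)
    fix t assume "finished c t \<le> i"
    then show "0 < proc (I ! c ! finished c t)"
      using received_front_less[OF assms(1), of t] received_sched_nonneg[OF assms(1), of t "finished c t"] assms(2)
      by linarith
  qed
qed simp

lemma feasible_sched: "feasible I sched"
proof -
  have "sched j t \<ge> 0" if "j \<in> job_ids I" "t \<ge> 1" for j t
    using that by (cases t; cases j) (auto simp: sched_Suc rate_nonneg job_ids_def)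
  moreover have "(\<Sum>j\<in>job_ids I. sched j t) \<le> 1" if "t \<ge> 1" for t
  proof -
    obtain s where s: "t = Suc s" using \<open>t \<ge> 1\<close> by (cases t) auto
    have "(\<Sum>j\<in>job_ids I. sched j t) = (\<Sum>c<n. \<Sum>i<length (I ! c). if i = finished c s then rate c s else 0)"
      unfolding sum_job_ids s by (intro sum.cong) (auto simp: sched_Suc)
    also have "\<dots> \<le> (\<Sum>c<n. rate c s)"
      by (intro sum_mono) (auto simp: rate_nonneg)
    finally show ?thesis using sum_rate_le[of s] by simp
  qed
  moreover have "completed I (received sched (t - 1)) (c, i')"
    if "(c, i) \<in> job_ids I" "t \<ge> 1" "sched (c, i) t > 0" "i' < i" for c i t i'
    using that completed_iff_less_finished[of i' c "t - 1"]
    by (cases t) (auto simp: sched_Suc job_ids_def split: if_splits)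
  moreover have "\<exists>t. completed I (received sched t) (c, i)" if "(c, i) \<in> job_ids I" for c i
  proof (rule ccontr)
    assume never: "\<nexists>t. completed I (received sched t) (c, i)"
    have c: "c < n" "i < length (I ! c)" using that by (auto simp: job_ids_def)
    have le: "finished c t \<le> i" for t
      using never completed_iff_less_finished[OF c(2), of t] by (auto simp: not_less)
    let ?f = "\<lambda>N. {t. t < N \<and> finished c (Suc t) = finished c t \<and> finished c t < Suc i}"
    let ?w = "\<lambda>N. {t. t < N \<and> finished c (Suc t) \<noteq> finished c t \<and> finished c t \<le> i}"
    \<comment> \<open>While job \<open>i\<close> is uncompleted, every step is full or wasted, and
      both kinds are bounded. The number \<open>N\<close> exceeds the sum of the two bounds.\<close>
    obtain N where N: "2 * real n * total_proc (take (Suc i) (I ! c)) +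
        real (card {i'. i' \<le> i \<and> proc (I ! c ! i') > 0}) < real N"
      using reals_Archimedean2 by blast
    have "{..<N} = ?f N \<union> ?w N" using le by (auto simp: less_Suc_eq_le)
    then have "card {..<N} = card (?f N \<union> ?w N)" by (rule arg_cong)
    also have "\<dots> \<le> card (?f N) + card (?w N)" by (rule card_Un_le)
    finally have "N \<le> card (?f N) + card (?w N)" by simp
    then show False
      using full_steps_le[OF c(1), of "Suc i" N] waste_steps_le[OF c, of N] c(2) N by linarith
  qed
  ultimately show ?thesis unfolding feasible_def by auto
qed

end

text \<open>Double counting: job \<open>i\<close> contributes its weight at each time of
  \<open>S\<close> at which it has not been dropped.\<close>

lemma sum_total_weight_drop:
  assumes "finite S"
  shows "(\<Sum>t\<in>S. total_weight (drop (g t) ch)) =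
    (\<Sum>i<length ch. weight (ch ! i) * real (card {t \<in> S. g t \<le> i}))"
proof -
  have "(\<Sum>t\<in>S. total_weight (drop (g t) ch)) =
      (\<Sum>i<length ch. weight (ch ! i) * (\<Sum>t\<in>S. of_bool (g t \<le> i)))"
    unfolding total_weight_drop by (subst sum.swap) (simp add: sum_distrib_left)
  also have "\<dots> = (\<Sum>i<length ch. weight (ch ! i) * real (card {t \<in> S. g t \<le> i}))"
    using assms by (intro sum.cong) (auto simp: of_bool_def sum.If_cases Int_def)
  finally show ?thesis .
qed

lemma under_chainE:
  assumes "wh < total_weight ch" "ch \<noteq> []"
  obtains k where "k \<le> length ch" "wh \<le> total_weight (take k ch)"
    "under_chain ch wh = Job (total_proc (take k ch)) (total_weight (take k ch) - wh) # drop k ch"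
proof -
  let ?P = "\<lambda>k. 1 \<le> k \<and> wh \<le> total_weight (take k ch)"
  \<comment> \<open>The full length is an admissible index, so the \<open>LEAST\<close> in
    \<open>under_chain\<close> is attained.\<close>
  have "?P (length ch)" using assms by (cases ch) auto
  then have "?P (LEAST k. ?P k)" and le: "(LEAST k. ?P k) \<le> length ch"
    by (rule LeastI[of ?P], rule Least_le[of ?P])
  then have wh: "wh \<le> total_weight (take (LEAST k. ?P k) ch)" by blast
  show ?thesis by (rule that[OF le wh]) (simp add: under_chain_def Let_def)
qed

section \<open>Charging the remaining weight to full and wasted steps\<close>

context damped_run
begin

text \<open>Unlike \<open>full_steps\<close> below, this excludes the idle steps after the end of
  the chain.\<close>

definition active :: "nat \<Rightarrow> nat \<Rightarrow> bool" where
  "active c t \<longleftrightarrow> finished c (Suc t) = finished c t \<and> finished c t < length (I ! c)"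

abbreviation "waste_steps c N \<equiv> {t. t < N \<and> finished c (Suc t) \<noteq> finished c t}"
abbreviation "full_steps c N \<equiv> {t. t < N \<and> finished c (Suc t) = finished c t}"

definition rem_weight :: "nat \<Rightarrow> nat \<Rightarrow> real" where
  "rem_weight c t = total_weight (drop (finished c t) (I ! c))"

definition under_load :: "nat \<Rightarrow> real" where
  "under_load c = (if Wh ! c < total_weight (I ! c) then load (under_chain (I ! c) (Wh ! c)) else 0)"

lemma residual_sched: "residual I sched c t = rem_weight c t"
  unfolding residual_def rem_weight_def total_weight_drop
  by (intro sum.cong) (auto simp: completed_iff_less_finished not_less)

lemma rem_weight_nonneg: "c < n \<Longrightarrow> rem_weight c t \<ge> 0"
  unfolding rem_weight_def by (rule total_weight_nonneg) (auto dest: in_set_dropD simp: valid_instanceD[OF valid])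

lemma rem_weight_antimono: "c < n \<Longrightarrow> s \<le> t \<Longrightarrow> rem_weight c t \<le> rem_weight c s"
  unfolding rem_weight_def total_weight_drop
  using finished_mono[of c s t]
  by (intro sum_mono mult_left_mono) (auto simp: valid_instanceD[OF valid])

lemma sum_split_steps:
  fixes g :: "nat \<Rightarrow> real"
  shows "(\<Sum>t<N. g t) = (\<Sum>t\<in>waste_steps c N. g t) + (\<Sum>t\<in>full_steps c N. g t)"
proof -
  have "{..<N} = waste_steps c N \<union> full_steps c N" by auto
  then have "(\<Sum>t<N. g t) = (\<Sum>t\<in>waste_steps c N \<union> full_steps c N. g t)" by (rule arg_cong)
  also have "\<dots> = (\<Sum>t\<in>waste_steps c N. g t) + (\<Sum>t\<in>full_steps c N. g t)"
    by (rule sum.union_disjoint) auto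
  finally show ?thesis .
qed

text \<open>Job \<open>i\<close> waits through at most as many wasted steps of its chain as there
  are jobs of positive requirement up to \<open>i\<close>, and every feasible schedule needs at
  least that many steps to complete it.\<close>

lemma waste_rem_weight_le:
  assumes "feasible I R"
  shows "(\<Sum>c<n. \<Sum>t\<in>waste_steps c N. rem_weight c t) \<le> cost I R"
proof -
  interpret R: feasible_schedule I R by unfold_locales (rule valid assms)+
  have "(\<Sum>t\<in>waste_steps c N. rem_weight c t) \<le>
      (\<Sum>i<length (I ! c). weight (I ! c ! i) * real (completion_time I R (c, i)))" if c: "c < n" for c
    unfolding rem_weight_def
  proof (subst sum_total_weight_drop, simp, intro sum_mono mult_left_mono)
    fix i assume "i \<in> {..<length (I ! c)}"
    then have i: "i < length (I ! c)" by simp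
    have "card {t \<in> waste_steps c N. finished c t \<le> i} \<le> card {i'. i' \<le> i \<and> proc (I ! c ! i') > 0}"
      using waste_steps_le[OF c i, of N] by simp
    also have "\<dots> \<le> completion_time I R (c, i)"
      by (rule R.card_positive_le_time[OF c i R.completed_completion_time[OF c i]])
    finally show "real (card {t \<in> waste_steps c N. finished c t \<le> i}) \<le> real (completion_time I R (c, i))"
      by simp
    show "0 \<le> weight (I ! c ! i)" using valid_instanceD(5)[OF valid c i] .
  qed
  then show ?thesis unfolding R.cost_eq by (intro sum_mono) auto
qed

lemma full_rem_weight_le:
  assumes "c < n"
  shows "(\<Sum>t\<in>full_steps c N. rem_weight c t) \<le> 2 * real n * load (I ! c)"
proof -
  have "(\<Sum>t\<in>full_steps c N. rem_weight c t) \<le>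
      (\<Sum>i<length (I ! c). weight (I ! c ! i) * (2 * real n * total_proc (take (Suc i) (I ! c))))"
    unfolding rem_weight_def
  proof (subst sum_total_weight_drop, simp, intro sum_mono mult_left_mono)
    fix i assume "i \<in> {..<length (I ! c)}"
    then have i: "i < length (I ! c)" by simp
    show "real (card {t \<in> full_steps c N. finished c t \<le> i}) \<le> 2 * real n * total_proc (take (Suc i) (I ! c))"
      using full_steps_le[OF assms, of "Suc i" N] i by (simp add: less_Suc_eq_le)
    show "0 \<le> weight (I ! c ! i)" using valid_instanceD(5)[OF valid assms i] .
  qed
  then show ?thesis unfolding load_def by (simp add: sum_distrib_left mult_ac)
qed

lemma cost_sched:
  obtains N where "cost I sched = (\<Sum>c<n. \<Sum>t<N. rem_weight c t)"
proof -
  interpret S: feasible_schedule I sched by unfold_locales (rule valid feasible_sched)+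
  from S.exists_horizon obtain N where "\<forall>c<n. \<forall>i<length (I ! c). completed I (received sched N) (c, i)"
    by blast
  from S.cost_eq_sum_residual[OF this] show ?thesis
    by (intro that) (simp add: residual_sched)
qed

text \<open>Wasted steps are charged to \<open>R\<close> directly. In full steps the equal share is
  slower than a dedicated machine by a factor of at most \<open>2 * real n\<close>, and the loads
  are a lower bound for \<open>R\<close>.\<close>

lemma cost_sched_le_width:
  assumes "feasible I R"
  shows "cost I sched \<le> (1 + 2 * real n) * cost I R"
proof -
  interpret R: feasible_schedule I R by unfold_locales (rule valid assms)+
  obtain N where N: "cost I sched = (\<Sum>c<n. \<Sum>t<N. rem_weight c t)" by (rule cost_sched)
  have "cost I sched = (\<Sum>c<n. \<Sum>t\<in>waste_steps c N. rem_weight c t) + (\<Sum>c<n. \<Sum>t\<in>full_steps c N. rem_weight c t)"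
    unfolding N sum.distrib[symmetric] by (rule sum.cong[OF refl]) (rule sum_split_steps)
  also have "\<dots> \<le> cost I R + (\<Sum>c<n. 2 * real n * load (I ! c))"
    by (intro add_mono waste_rem_weight_le assms sum_mono full_rem_weight_le) simp
  also have "\<dots> \<le> cost I R + 2 * real n * cost I R"
    unfolding sum_distrib_left[symmetric] by (intro add_left_mono mult_left_mono R.load_le_cost) simp
  finally show ?thesis by (simp add: algebra_simps)
qed

text \<open>Remaining weight beyond the claim is weight that was not predicted. It is dominated by
  what is left of the underpredicted chain, which the equal share serves at speed at least
  \<open>1 / (2 * real n)\<close> in full steps.\<close>

lemma excess_le:
  assumes c: "c < n"
  shows "(\<Sum>t\<in>full_steps c N. max 0 (rem_weight c t - pclaim c t)) \<le> 2 * real n * under_load c"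
proof -
  let ?ch = "I ! c"
  have rem: "rem_weight c t = total_weight ?ch - total_weight (take (finished c t) ?ch)" for t
    unfolding rem_weight_def using total_weight_take_drop[of "finished c t" ?ch] by simp
  have rem0: "rem_weight c t = 0" if "\<not> finished c t < length ?ch" for t
    using that by (simp add: rem_weight_def total_weight_def)
  show ?thesis
  proof (cases "Wh ! c < total_weight ?ch")
    case False
    have "rem_weight c t \<le> pclaim c t" for t
      using rem[of t] rem0[of t] False by (auto simp: pclaim_def)
    then have "max 0 (rem_weight c t - pclaim c t) = 0" for t by (intro max_absorb1) simp
    then show ?thesis using False by (simp add: under_load_def)
  next
    case True
    obtain k where k: "k \<le> length ?ch" "Wh ! c \<le> total_weight (take k ?ch)"
      and J: "under_chain ?ch (Wh ! c) =
        Job (total_proc (take k ?ch)) (total_weight (take k ?ch) - Wh ! c) # drop k ?ch" (is "?J = _")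
      using under_chainE[OF True valid_instanceD(1)[OF valid c]] by metis
    have Jw: "weight j \<ge> 0" if "j \<in> set ?J" for j
      using that k(2) valid_instanceD(3)[OF valid c] by (auto simp: J dest: in_set_dropD)
    \<comment> \<open>The truncated subtraction is 0 while fewer than \<open>k\<close> jobs are
      finished, so the merged first job still counts. From the \<open>k\<close>-th completion on it
      is dropped, and later jobs disappear as they complete.\<close>
    have le: "max 0 (rem_weight c t - pclaim c t) \<le> total_weight (drop (Suc (finished c t) - k) ?J)" for t
    proof (cases "finished c t < k")
      case less: True
      have "total_weight ?J = total_weight (take k ?ch) - Wh ! c + total_weight (drop k ?ch)"
        by (simp add: J total_weight_def)
      then have "total_weight ?J = total_weight ?ch - Wh ! c"
        using total_weight_take_drop[of k ?ch] by simp
      moreover have "pclaim c t \<ge> Wh ! c - total_weight (take (finished c t) ?ch)"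
        using less k(1) by (simp add: pclaim_def)
      ultimately show ?thesis using less rem[of t] True by simp
    next
      case False
      then have "drop (Suc (finished c t) - k) ?J = drop (finished c t) ?ch"
        by (simp add: J Suc_diff_le)
      then show ?thesis using rem_weight_nonneg[OF c, of t] pclaim_nonneg[of c t]
        by (simp add: rem_weight_def)
    qed
    have "(\<Sum>t\<in>full_steps c N. max 0 (rem_weight c t - pclaim c t))
        \<le> (\<Sum>t\<in>full_steps c N. total_weight (drop (Suc (finished c t) - k) ?J))"
      by (intro sum_mono le)
    also have "\<dots> \<le> (\<Sum>m<length ?J. weight (?J ! m) * (2 * real n * total_proc (take (Suc m) ?J)))"
    proof (subst sum_total_weight_drop, simp, intro sum_mono mult_left_mono)
      fix m assume m: "m \<in> {..<length ?J}"
      then have "k + m \<le> length ?ch" using k(1) by (simp add: J)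
      moreover have "total_proc (take (Suc m) ?J) = total_proc (take (k + m) ?ch)"
        by (simp add: J take_add total_proc_append) (simp add: total_proc_def)
      moreover have "{t \<in> full_steps c N. Suc (finished c t) - k \<le> m} =
          {t. t < N \<and> finished c (Suc t) = finished c t \<and> finished c t < k + m}" by auto
      ultimately show "real (card {t \<in> full_steps c N. Suc (finished c t) - k \<le> m})
          \<le> 2 * real n * total_proc (take (Suc m) ?J)"
        using full_steps_le[OF c, of "k + m" N] by simp
      show "0 \<le> weight (?J ! m)" using m by (intro Jw) auto
    qed
    also have "\<dots> = 2 * real n * under_load c"
      using True by (simp add: under_load_def load_def sum_distrib_left mult_ac)
    finally show ?thesis .
  qed
qed

text \<open>Every step that completes a job buys four steps in which the chain may be starved.\<close>

lemma penalized_rem_weight_le: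
  assumes c: "c < n"
  shows "(\<Sum>t\<in>{t \<in> full_steps c N. pen c t > 0}. rem_weight c t) + real (pen c N) * rem_weight c N
    \<le> 4 * (\<Sum>t\<in>waste_steps c N. rem_weight c t)"
\<comment> \<open>The second summand is unspent credit. A wasted step buys four units at the current
  remaining weight, a damped full step spends one, and the value of a unit only decreases with
  time.\<close>
proof (induction N)
  case 0
  then show ?case by (simp add: pen_0)
next
  case (Suc N)
  let ?A = "\<lambda>N. {t \<in> full_steps c N. pen c t > 0}"
  have g: "rem_weight c (Suc N) \<le> rem_weight c N" "rem_weight c (Suc N) \<ge> 0"
    using rem_weight_antimono[OF c] rem_weight_nonneg[OF c] by auto
  consider "finished c (Suc N) \<noteq> finished c N" | "finished c (Suc N) = finished c N" "pen c N = 0"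
    | p where "finished c (Suc N) = finished c N" "pen c N = Suc p" by (cases "pen c N") auto
  then show ?case
  proof cases
    case 1
    then have "?A (Suc N) = ?A N" "waste_steps c (Suc N) = insert N (waste_steps c N)"
      by (auto simp: less_Suc_eq)
    moreover have "real (pen c N + 4) * rem_weight c (Suc N) \<le> real (pen c N + 4) * rem_weight c N"
      using g by (intro mult_left_mono) auto
    ultimately show ?thesis using Suc 1 by (simp add: pen_Suc[OF c] algebra_simps)
  next
    case 2
    then have "?A (Suc N) = ?A N" "waste_steps c (Suc N) = waste_steps c N"
      by (auto simp: less_Suc_eq)
    then show ?thesis using Suc 2 by (simp add: pen_Suc[OF c])
  next
    case 3
    then have "?A (Suc N) = insert N (?A N)" "waste_steps c (Suc N) = waste_steps c N"
      by (auto simp: less_Suc_eq)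
    moreover have "real p * rem_weight c (Suc N) \<le> real p * rem_weight c N"
      using g by (intro mult_left_mono) auto
    ultimately show ?thesis using Suc 3 by (simp add: pen_Suc[OF c] algebra_simps)
  qed
qed

text \<open>Wasted steps count once for themselves and four times for the damped full steps they
  cause. In the other full steps the damping factor is 1, so the remaining weight is at most the
  damped claim plus the unpredicted excess.\<close>

lemma sum_rem_weight_le:
  assumes c: "c < n"
  shows "(\<Sum>t<N. rem_weight c t) \<le> 5 * (\<Sum>t\<in>waste_steps c N. rem_weight c t) +
    (\<Sum>t<N. dclaim c t) + 2 * real n * under_load c"
proof -
  let ?F = "full_steps c N"
  have "(\<Sum>t\<in>?F. rem_weight c t) = (\<Sum>t\<in>{t \<in> ?F. pen c t > 0}. rem_weight c t) +
      (\<Sum>t\<in>{t \<in> ?F. pen c t = 0}. rem_weight c t)"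
    by (subst sum.union_disjoint[symmetric]) (auto intro!: sum.cong)
  moreover have "(\<Sum>t\<in>{t \<in> ?F. pen c t = 0}. rem_weight c t) \<le>
      (\<Sum>t<N. dclaim c t) + (\<Sum>t\<in>?F. max 0 (rem_weight c t - pclaim c t))"
  proof -
    have "(\<Sum>t\<in>{t \<in> ?F. pen c t = 0}. rem_weight c t) \<le>
        (\<Sum>t\<in>{t \<in> ?F. pen c t = 0}. dclaim c t + max 0 (rem_weight c t - pclaim c t))"
      by (intro sum_mono) (auto simp: dclaim_def)
    also have "\<dots> \<le> (\<Sum>t<N. dclaim c t) + (\<Sum>t\<in>?F. max 0 (rem_weight c t - pclaim c t))"
      unfolding sum.distrib by (intro add_mono sum_mono2) (auto simp: dclaim_nonneg)
    finally show ?thesis .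
  qed
  moreover have "real (pen c N) * rem_weight c N \<ge> 0" using rem_weight_nonneg[OF c] by simp
  ultimately show ?thesis
    using penalized_rem_weight_le[OF c, of N] excess_le[OF c, of N] sum_split_steps[of "rem_weight c" N c]
    by linarith
qed

section \<open>Decay and recovery of the damped claims\<close>

lemma pclaim_antimono:
  assumes "c < n" "s \<le> t" shows "pclaim c t \<le> pclaim c s"
proof -
  have "total_weight (take (finished c s) (I ! c)) \<le> total_weight (take (finished c t) (I ! c))"
    using rem_weight_antimono[OF assms] total_weight_take_drop[of _ "I ! c"]
    unfolding rem_weight_def by (smt (verit))
  then show ?thesis using finished_mono[OF assms] by (auto simp: pclaim_def)
qed

text \<open>The exponent changes by at most 1 downwards in an active step and by 4 upwards in a
  wasted one, where \<open>(4/5)^4\<close> is below \<open>1/2\<close>. In the remaining case the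
  chain has ended and both claims are 0.\<close>

lemma dclaim_Suc:
  assumes c: "c < n"
  shows "dclaim c (Suc t) \<le> (if active c t then 5/4 else 1/2) * dclaim c t"
proof -
  have mono: "dclaim c (Suc t) \<le> pclaim c t * (4/5) ^ pen c (Suc t)"
    unfolding dclaim_def using pclaim_antimono[OF c, of t "Suc t"] by (intro mult_right_mono) auto
  consider "active c t" | "finished c (Suc t) \<noteq> finished c t"
    | "\<not> active c t" "finished c (Suc t) = finished c t" by blast
  then show ?thesis
  proof cases
    case 1
    then have "pen c (Suc t) = pen c t - 1" by (simp add: pen_Suc[OF c] active_def)
    moreover have "(4/5::real) ^ (p - 1) \<le> 5/4 * (4/5) ^ p" for p by (cases p) auto
    ultimately have "pclaim c t * (4/5) ^ pen c (Suc t) \<le> pclaim c t * (5/4 * (4/5) ^ pen c t)"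
      using pclaim_nonneg by (intro mult_left_mono) auto
    also have "\<dots> = 5/4 * dclaim c t" by (simp add: dclaim_def)
    finally show ?thesis using mono 1 by simp
  next
    case 2
    then have "pen c (Suc t) = pen c t + 4" by (simp add: pen_Suc[OF c])
    then have "pclaim c t * (4/5) ^ pen c (Suc t) = (4/5)^4 * dclaim c t"
      by (simp add: dclaim_def power_add)
    also have "\<dots> \<le> 1/2 * dclaim c t"
      using dclaim_nonneg by (intro mult_right_mono) (auto simp: power_divide)
    finally show ?thesis using mono 2 by (simp add: active_def)
  next
    case 3
    then have "dclaim c t = 0" "dclaim c (Suc t) = 0"
      by (auto simp: active_def dclaim_def pclaim_def)
    then show ?thesis by simp
  qed
qed

definition active_claim :: "nat \<Rightarrow> real" where
  "active_claim t = (\<Sum>c<n. dclaim c t * of_bool (active c t))"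

lemma active_claim_bounds: "0 \<le> active_claim t" "active_claim t \<le> total_claim t"
  unfolding active_claim_def total_claim_def using dclaim_nonneg
  by (auto intro: sum_nonneg) (rule sum_mono2; simp)

lemma total_claim_Suc:
  "total_claim (Suc t) \<le> total_claim t - (total_claim t - active_claim t) / 2 + active_claim t / 4"
proof -
  have "total_claim (Suc t) \<le> (\<Sum>c<n. 1/2 * dclaim c t + 3/4 * (dclaim c t * of_bool (active c t)))"
    unfolding total_claim_def
  proof (rule sum_mono)
    fix c assume "c \<in> {..<n}"
    then show "dclaim c (Suc t) \<le> 1/2 * dclaim c t + 3/4 * (dclaim c t * of_bool (active c t))"
      using dclaim_Suc[of c t] by (cases "active c t") auto
  qed
  also have "\<dots> = 1/2 * total_claim t + 3/4 * active_claim t"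
    unfolding total_claim_def active_claim_def by (simp only: sum.distrib sum_distrib_left)
  finally show ?thesis by (simp add: field_simps)
qed

text \<open>Wasted claim shrinks at least by half and active claim grows at most by a quarter. As
  the total stays nonnegative, wasted claim is controlled by the initial claim and the active claim.
  The quotient on the right is the mutual delay of the active chains up to a constant
  factor.\<close>

lemma sum_total_claim_le:
  "(\<Sum>t<N. total_claim t) \<le> 8 * total_claim 0 + 3 * (\<Sum>t<N. (active_claim t)\<^sup>2 / total_claim t)"
proof -
  have 1: "(\<Sum>t<N. (total_claim t - active_claim t) / 2) + total_claim N \<le>
      total_claim 0 + (\<Sum>t<N. active_claim t / 4)"
  proof (induction N)
    case (Suc N)
    then show ?case using total_claim_Suc[of N] by simp
  qed simp
  have "active_claim t \<le> (active_claim t)\<^sup>2 / total_claim t + (total_claim t - active_claim t)" for t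
  proof (cases "total_claim t = 0")
    case True
    then show ?thesis using active_claim_bounds[of t] by simp
  next
    case False
    then have pos: "total_claim t > 0" using total_claim_nonneg[of t] by simp
    \<comment> \<open>The difference of the two sides is the square of
      \<open>total_claim t - active_claim t\<close>.\<close>
    have "active_claim t * total_claim t \<le>
        (active_claim t)\<^sup>2 + (total_claim t - active_claim t) * total_claim t"
      using zero_le_power2[of "total_claim t - active_claim t"]
      by (simp add: power2_eq_square algebra_simps)
    then show ?thesis using pos by (simp add: field_simps)
  qed
  then have 2: "(\<Sum>t<N. active_claim t) \<le> (\<Sum>t<N. (active_claim t)\<^sup>2 / total_claim t) +
      (\<Sum>t<N. total_claim t - active_claim t)"
    unfolding sum.distrib[symmetric] by (intro sum_mono)
  define S A where "S = (\<Sum>t<N. total_claim t)" and "A = (\<Sum>t<N. active_claim t)"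
  \<comment> \<open>With \<open>Q\<close> for the sum of quotients, this and
    \<open>2 * A \<le> Q + S\<close> give \<open>S \<le> 2 * total_claim 0 + 3/4 * (Q + S)\<close>,
    which is solved for \<open>S\<close>.\<close>
  have "S - A \<le> 2 * total_claim 0 + A / 2"
    using 1 total_claim_nonneg[of N]
    unfolding sum_divide_distrib[symmetric] sum_subtractf S_def A_def by argo
  moreover have "2 * A \<le> (\<Sum>t<N. (active_claim t)\<^sup>2 / total_claim t) + S"
    using 2 unfolding sum_subtractf S_def A_def by argo
  ultimately show ?thesis unfolding S_def[symmetric] by argo
qed

section \<open>Claims as functions of progress, and comparison with a path\<close>

text \<open>This is the claim of a chain that has received \<open>x\<close> units of processing,
  independent of any schedule. It serves as the weight function along the compared paths.\<close>

definition level :: "nat \<Rightarrow> real \<Rightarrow> real" where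
  "level c x = (if x < total_proc (I ! c)
     then max 0 (Wh ! c - (\<Sum>i<length (I ! c). weight (I ! c ! i) *
                             of_bool (total_proc (take (Suc i) (I ! c)) \<le> x)))
     else 0)"

lemma level_nonneg: "level c x \<ge> 0"
  by (simp add: level_def)

text \<open>Before \<open>x\<close> reaches the end of the front job, only jobs in front of it can
  be covered by \<open>x\<close>, so at most the finished weight has been subtracted.\<close>

lemma pclaim_le_level:
  assumes c: "c < n" and k: "finished c t < length (I ! c)"
    and x: "x < total_proc (take (Suc (finished c t)) (I ! c))"
  shows "pclaim c t \<le> level c x"
proof -
  have mono: "total_proc (take q (I ! c)) \<le> total_proc (take q' (I ! c))" if "q \<le> q'" for q q'
    using that valid_instanceD(2)[OF valid c] by (intro total_proc_take_mono) auto
  have "x < total_proc (I ! c)" using x mono[of "Suc (finished c t)" "length (I ! c)"] k by simp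
  moreover have "(\<Sum>i<length (I ! c). weight (I ! c ! i) * of_bool (total_proc (take (Suc i) (I ! c)) \<le> x))
      \<le> (\<Sum>i<length (I ! c). if i < finished c t then weight (I ! c ! i) else 0)"
  proof (rule sum_mono)
    fix i assume "i \<in> {..<length (I ! c)}"
    then show "weight (I ! c ! i) * of_bool (total_proc (take (Suc i) (I ! c)) \<le> x)
        \<le> (if i < finished c t then weight (I ! c ! i) else 0)"
      using mono[of "Suc (finished c t)" "Suc i"] x valid_instanceD(5)[OF valid c, of i] by auto
  qed
  moreover have "(\<Sum>i<length (I ! c). if i < finished c t then weight (I ! c ! i) else 0)
      = total_weight (take (finished c t) (I ! c))"
    using k by (subst total_weight_take) (auto intro!: sum.mono_neutral_cong_right split: if_splits)
  ultimately show ?thesis using k by (simp add: pclaim_def level_def)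
qed

lemma total_claim_0_le: "total_claim 0 \<le> (\<Sum>c<n. level c 0)"
  unfolding total_claim_def
proof (rule sum_mono)
  fix c assume "c \<in> {..<n}"
  then have c: "c < n" by simp
  show "dclaim c 0 \<le> level c 0"
  proof (cases "finished c 0 < length (I ! c)")
    case True
    have "0 < proc (I ! c ! finished c 0)"
      using received_front_less[OF c True] by (simp add: received_0)
    also have "\<dots> \<le> total_proc (take (Suc (finished c 0)) (I ! c))"
      using True valid_instanceD(4)[OF valid c]
      by (subst total_proc_take) (auto intro!: sum_nonneg)
    finally show ?thesis using pclaim_le_level[OF c True] dclaim_le_pclaim[of c 0] by force
  next
    case False
    then show ?thesis by (simp add: dclaim_def pclaim_def level_nonneg)
  qed
qed

text \<open>The path \<open>z\<close> runs at total speed at most 2. Mutual delays of all ordered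
  pairs of chains are compared with those along \<open>z\<close>, where they sum to at most twice
  the weighted level. The initial claim is covered by the first summand, which exists because
  \<open>T > 0\<close>.\<close>

lemma sum_total_claim_le_path:
  assumes z: "\<And>c. c < n \<Longrightarrow> mono (z c)" "\<And>c. c < n \<Longrightarrow> z c 0 = 0"
      "\<And>c. c < n \<Longrightarrow> total_proc (I ! c) \<le> z c T"
    and speed: "\<And>s. (\<Sum>c<n. z c (Suc s) - z c s) \<le> (2::real)" and "T > 0"
  shows "(\<Sum>t<N. total_claim t) \<le> 32 * (\<Sum>s<T. \<Sum>c<n. level c (z c s))"
proof -
  \<comment> \<open>\<open>q i j t\<close> is the delay of chain \<open>i\<close> by the guaranteed
    proportional share of chain \<open>j\<close>. It is symmetric in \<open>i\<close> and
    \<open>j\<close>, as the comparison requires. Along \<open>z\<close>, the corresponding delay is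
    \<open>w i j\<close>.\<close>
  define q where "q = (\<lambda>i j t. dclaim i t * dclaim j t / (2 * total_claim t))"
  define w where "w = (\<lambda>i j. \<Sum>s<T. level i (z i s) * (z j (Suc s) - z j s))"
  let ?B = "\<lambda>i j. {t. t < N \<and> active i t \<and> active j t}"
  let ?V = "\<Sum>s<T. \<Sum>c<n. level c (z c s)"
  have lev: "dclaim c t \<le> level c x" if "c < n" "active c t" "x < prog c (Suc t)" for c t x
    using that prog_le[of c "Suc t" "Suc (finished c t)"] dclaim_le_pclaim[of c t]
      pclaim_le_level[of c t x]
    by (auto simp: active_def)
  have speed_ge: "dclaim i t * (prog j (Suc t) - prog j t) \<ge> q i j t" if "j < n" "active j t" for i j t
  proof -
    have "prog j (Suc t) - prog j t \<ge> dclaim j t / (2 * total_claim t)"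
      using that prog_full_step[of j t] rate_ge(2)[of j t] by (auto simp: active_def)
    from mult_left_mono[OF this dclaim_nonneg[of i t]] show ?thesis by (simp add: q_def)
  qed
  have q_comm: "q i j t = q j i t" for i j t by (simp add: q_def mult.commute)
  have pair: "(\<Sum>t\<in>?B i j. q i j t) \<le> w i j + w j i" if ij: "i < n" "j < n" for i j
    unfolding w_def
  proof (rule path_le)
    show "mono (z i)" "mono (z j)" using z ij by auto
    show "mono (prog i)" "mono (prog j)" using prog_mono ij by (auto simp: mono_def)
    show "z i 0 \<le> prog i 0" "z j 0 \<le> prog j 0" using z ij by (auto simp: prog_0)
    show "prog i N \<le> z i T" "prog j N \<le> z j T"
      using z(3) prog_le_total ij by (meson order_trans)+
    show "dclaim i t \<le> level i x" if "t \<in> ?B i j" "x < prog i (Suc t)" for t x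
      using that lev[OF ij(1)] by simp
    show "dclaim j t \<le> level j x" if "t \<in> ?B i j" "x < prog j (Suc t)" for t x
      using that lev[OF ij(2)] by simp
    show "q i j t \<le> dclaim i t * (prog j (Suc t) - prog j t)" if "t \<in> ?B i j" for t
      using that speed_ge[OF ij(2)] by simp
    show "q i j t \<le> dclaim j t * (prog i (Suc t) - prog i t)" if "t \<in> ?B i j" for t
      using that speed_ge[OF ij(1)] q_comm[of i j t] by simp
  qed (auto simp: level_nonneg)
  have "(active_claim t)\<^sup>2 / total_claim t =
      2 * (\<Sum>i<n. \<Sum>j<n. q i j t * of_bool (active i t \<and> active j t))" for t
  proof -
    have "(active_claim t)\<^sup>2 / total_claim t = (\<Sum>i<n. \<Sum>j<n.
        (dclaim i t * of_bool (active i t)) * (dclaim j t * of_bool (active j t)) / total_claim t)"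
      unfolding active_claim_def power2_eq_square sum_product sum_divide_distrib by (rule refl)
    also have "\<dots> = (\<Sum>i<n. \<Sum>j<n. 2 * (q i j t * of_bool (active i t \<and> active j t)))"
      by (intro sum.cong) (auto simp: q_def)
    finally show ?thesis by (simp only: sum_distrib_left)
  qed
  then have "(\<Sum>t<N. (active_claim t)\<^sup>2 / total_claim t) =
      2 * (\<Sum>t<N. \<Sum>i<n. \<Sum>j<n. q i j t * of_bool (active i t \<and> active j t))"
    by (simp only: sum_distrib_left)
  also have "(\<Sum>t<N. \<Sum>i<n. \<Sum>j<n. q i j t * of_bool (active i t \<and> active j t)) =
      (\<Sum>i<n. \<Sum>j<n. \<Sum>t<N. q i j t * of_bool (active i t \<and> active j t))"
    by (rule trans[OF sum.swap]) (intro sum.cong refl sum.swap)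
  also have "\<dots> = (\<Sum>i<n. \<Sum>j<n. \<Sum>t\<in>?B i j. q i j t)"
    by (intro sum.cong refl sum.mono_neutral_cong_right) auto
  also have "\<dots> \<le> (\<Sum>i<n. \<Sum>j<n. w i j + w j i)"
    by (intro sum_mono pair) auto
  also have "\<dots> = 2 * (\<Sum>i<n. \<Sum>j<n. w i j)"
    unfolding sum.distrib using sum.swap[of "\<lambda>i j. w j i" "{..<n}" "{..<n}"] by simp
  \<comment> \<open>Summed over all pairs, the delay in a step of \<open>z\<close> factors into the
    total level and the total speed.\<close>
  also have "(\<Sum>i<n. \<Sum>j<n. w i j) = (\<Sum>s<T. (\<Sum>i<n. level i (z i s)) * (\<Sum>j<n. z j (Suc s) - z j s))"
  proof -
    have "(\<Sum>i<n. \<Sum>j<n. w i j) = (\<Sum>i<n. \<Sum>s<T. \<Sum>j<n. level i (z i s) * (z j (Suc s) - z j s))"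
      unfolding w_def by (intro sum.cong refl sum.swap)
    also have "\<dots> = (\<Sum>s<T. \<Sum>i<n. \<Sum>j<n. level i (z i s) * (z j (Suc s) - z j s))"
      by (rule sum.swap)
    finally show ?thesis by (simp add: sum_product)
  qed
  also have "\<dots> \<le> (\<Sum>s<T. (\<Sum>i<n. level i (z i s)) * 2)"
    by (intro sum_mono mult_left_mono speed sum_nonneg level_nonneg)
  also have "\<dots> = 2 * ?V" by (simp add: sum_distrib_left mult.commute)
  finally have Q: "(\<Sum>t<N. (active_claim t)\<^sup>2 / total_claim t) \<le> 8 * ?V" by simp
  have "(\<Sum>c<n. level c 0) = (\<Sum>c<n. level c (z c 0))" using z(2) by simp
  also have "\<dots> \<le> ?V"
    using \<open>T > 0\<close> by (intro member_le_sum[of 0 "{..<T}" "\<lambda>s. \<Sum>c<n. level c (z c s)"]) (auto intro!: sum_nonneg level_nonneg)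
  finally have "total_claim 0 \<le> ?V" using total_claim_0_le by simp
  \<comment> \<open>The constant is 8 for the initial claim plus 3 times 8 for the mutual
    delays.\<close>
  with Q sum_total_claim_le[of N] show ?thesis by simp
qed

end

section \<open>The overpredicted and the underpredicted part\<close>

lemma concat_map_if: "concat (map (\<lambda>x. if P x then [g x] else []) xs) = map g (filter P xs)"
  by (induction xs) auto

text \<open>Chains carry no names, so the index in a filtered instance differs from the index in
  \<open>I\<close>. The bijection \<open>pos\<close> translates between them when sums over chains
  are reindexed.\<close>

lemma filtered_positions:
  obtains pos where "bij_betw pos {c. c < n \<and> P c} {..<length (map g (filter P [0..<n]))}"
    "\<And>c. c < n \<Longrightarrow> P c \<Longrightarrow> map g (filter P [0..<n]) ! pos c = g c"
proof -
  let ?xs = "filter P [0..<n]"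
  have bij: "bij_betw ((!) ?xs) {..<length ?xs} {c. c < n \<and> P c}"
    by (rule bij_betw_nth) auto
  let ?pos = "the_inv_into {..<length ?xs} ((!) ?xs)"
  have inv: "bij_betw ?pos {c. c < n \<and> P c} {..<length ?xs}"
    using bij by (rule bij_betw_the_inv_into)
  moreover have "map g ?xs ! ?pos c = g c" if "c < n" "P c" for c
  proof -
    have "?pos c < length ?xs" using bij_betwE[OF inv] that by auto
    moreover have "?xs ! ?pos c = c"
      using bij that by (intro f_the_inv_into_f_bij_betw) auto
    ultimately show ?thesis by simp
  qed
  ultimately show ?thesis by (intro that[of ?pos]) auto
qed

lemma zip_conv_map: "length ys = length xs \<Longrightarrow> zip xs ys = map (\<lambda>c. (xs ! c, ys ! c)) [0..<length xs]"
  by (rule nth_equalityI) auto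

lemma C_over_eq:
  assumes "length Wh = length I"
  shows "C_over I Wh = map (\<lambda>c. over_chain (I ! c) (Wh ! c))
    (filter (\<lambda>c. Wh ! c > total_weight (I ! c)) [0..<length I])"
  unfolding C_over_def zip_conv_map[OF assms] map_map
  by (simp add: concat_map_if[symmetric] comp_def)

lemma C_under_eq:
  assumes "length Wh = length I"
  shows "C_under I Wh = map (\<lambda>c. under_chain (I ! c) (Wh ! c))
    (filter (\<lambda>c. Wh ! c < total_weight (I ! c)) [0..<length I])"
  unfolding C_under_def zip_conv_map[OF assms] map_map
  by (simp add: concat_map_if[symmetric] comp_def)

lemma total_proc_nonneg:
  "(\<And>j. j \<in> set ch \<Longrightarrow> proc j \<ge> 0) \<Longrightarrow> total_proc ch \<ge> 0"
  unfolding total_proc_def by (rule sum_list_nonneg) auto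

lemma valid_C_over:
  assumes "valid_instance I" "length Wh = length I"
  shows "valid_instance (C_over I Wh)"
  using valid_instanceD[OF assms(1)]
  by (auto simp: C_over_eq[OF assms(2)] valid_instance_def over_chain_def intro!: total_proc_nonneg)

lemma valid_C_under:
  assumes "valid_instance I" "length Wh = length I"
  shows "valid_instance (C_under I Wh)"
proof -
  have "ch' \<noteq> [] \<and> (\<forall>j\<in>set ch'. proc j \<ge> 0 \<and> weight j \<ge> 0)"
    if "c < length I" "Wh ! c < total_weight (I ! c)" "ch' = under_chain (I ! c) (Wh ! c)" for c ch'
  proof -
    note v = valid_instanceD[OF assms(1) that(1)] and ch' = that(3)
    obtain k where k: "Wh ! c \<le> total_weight (take k (I ! c))" "ch' =
        Job (total_proc (take k (I ! c))) (total_weight (take k (I ! c)) - Wh ! c) # drop k (I ! c)"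
      using under_chainE[OF \<open>Wh ! c < _\<close> v(1)] ch' by metis
    have "total_proc (take k (I ! c)) \<ge> 0"
      using v(2) by (intro total_proc_nonneg) (auto dest: in_set_takeD)
    then show ?thesis using k v(2,3) by (auto dest: in_set_dropD)
  qed
  then show ?thesis by (auto simp: C_under_eq[OF assms(2)] valid_instance_def)
qed

context damped_run
begin

lemma sum_under_load_le:
  assumes "feasible (C_under I Wh) R"
  shows "(\<Sum>c<n. under_load c) \<le> cost (C_under I Wh) R"
proof -
  let ?J = "C_under I Wh"
  interpret R: feasible_schedule ?J R
    by unfold_locales (rule valid_C_under[OF valid len], rule assms)
  obtain pos where pos: "bij_betw pos {c. c < n \<and> Wh ! c < total_weight (I ! c)} {..<length ?J}"
    "\<And>c. c < n \<Longrightarrow> Wh ! c < total_weight (I ! c) \<Longrightarrow> ?J ! pos c = under_chain (I ! c) (Wh ! c)"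
    unfolding C_under_eq[OF len]
    using filtered_positions[of n "\<lambda>c. Wh ! c < total_weight (I ! c)" "\<lambda>c. under_chain (I ! c) (Wh ! c)"]
    by blast
  have "(\<Sum>c<n. under_load c) = (\<Sum>c | c < n \<and> Wh ! c < total_weight (I ! c). under_load c)"
    by (intro sum.mono_neutral_right) (auto simp: under_load_def)
  also have "\<dots> = (\<Sum>c | c < n \<and> Wh ! c < total_weight (I ! c). load (?J ! pos c))"
    by (intro sum.cong) (auto simp: under_load_def pos(2))
  also have "\<dots> = (\<Sum>k<length ?J. load (?J ! k))"
    by (rule sum.reindex_bij_betw[OF pos(1)])
  also have "\<dots> \<le> cost ?J R" by (rule R.load_le_cost)
  finally show ?thesis .
qed

text \<open>An unfinished level splits into true weight not yet completed, paid by \<open>R\<close>,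
  and overpredicted weight, paid by \<open>R'\<close>. As soon as either schedule has processed the
  chain in full, the level is 0.\<close>

lemma sum_total_claim_le_cost:
  assumes R: "feasible I R" and R': "feasible (C_over I Wh) R'"
  shows "(\<Sum>t<N. total_claim t) \<le> 32 * (cost I R + cost (C_over I Wh) R')"
proof -
  let ?J = "C_over I Wh"
  let ?over = "{c. c < n \<and> Wh ! c > total_weight (I ! c)}"
  interpret R: feasible_schedule I R by unfold_locales (rule valid R)+
  interpret R': feasible_schedule ?J R'
    by unfold_locales (rule valid_C_over[OF valid len], rule R')
  obtain pos where pos: "bij_betw pos ?over {..<length ?J}"
    "\<And>c. c < n \<Longrightarrow> Wh ! c > total_weight (I ! c) \<Longrightarrow> ?J ! pos c = over_chain (I ! c) (Wh ! c)"
    unfolding C_over_eq[OF len]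
    using filtered_positions[of n "\<lambda>c. Wh ! c > total_weight (I ! c)" "\<lambda>c. over_chain (I ! c) (Wh ! c)"]
    by blast
  have pos_less: "pos c < length ?J" if "c \<in> ?over" for c
    using bij_betwE[OF pos(1)] that by auto
  define y where "y = (\<lambda>c s. if c \<in> ?over then progress ?J R' (pos c) s else 0)"
  define r where "r = (\<lambda>c s. if c \<in> ?over then residual ?J R' (pos c) s else 0)"
  \<comment> \<open>Taking the larger progress chain by chain keeps the path monotone, and in each
    step it advances by at most the sum of the two advances, which accounts for total speed
    2.\<close>
  define z where "z = (\<lambda>c s. max (progress I R c s) (y c s))"
  have over_sum: "(\<Sum>c<n. if c \<in> ?over then g (pos c) else 0) = (\<Sum>k<length ?J. g k)"
    for g :: "nat \<Rightarrow> real"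
  proof -
    have "(\<Sum>c<n. if c \<in> ?over then g (pos c) else 0) = (\<Sum>c\<in>?over. g (pos c))"
      by (intro sum.mono_neutral_cong_right) auto
    also have "\<dots> = (\<Sum>k<length ?J. g k)" by (rule sum.reindex_bij_betw[OF pos(1)])
    finally show ?thesis .
  qed
  have y_mono: "y c s \<le> y c s'" if "s \<le> s'" for c s s'
    using that R'.progress_mono[OF pos_less] by (auto simp: y_def)
  from R.exists_horizon obtain T\<^sub>0 where
    T\<^sub>0: "\<forall>c<n. \<forall>i<length (I ! c). \<forall>t\<ge>T\<^sub>0. completed I (received R t) (c, i)" by blast
  \<comment> \<open>The successor makes the length of the path positive even if
    \<open>T\<^sub>0\<close> is 0.\<close>
  have "(\<Sum>t<N. total_claim t) \<le> 32 * (\<Sum>s<Suc T\<^sub>0. \<Sum>c<n. level c (z c s))"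
  proof (rule sum_total_claim_le_path)
    fix c assume c: "c < n"
    show "mono (z c)"
      unfolding mono_def z_def by (intro allI impI max.mono R.progress_mono[OF c] y_mono)
    show "z c 0 = 0"
      using R.progress_0[OF c] R'.progress_0[OF pos_less] by (auto simp: z_def y_def)
    have last: "length (I ! c) - 1 < length (I ! c)" using valid_instanceD(1)[OF valid c] by (cases "I ! c") auto
    then have "total_proc (take (Suc (length (I ! c) - 1)) (I ! c)) \<le> progress I R c (Suc T\<^sub>0)"
      using T\<^sub>0 c by (intro R.completed_progress) auto
    then show "total_proc (I ! c) \<le> z c (Suc T\<^sub>0)" using last by (auto simp: z_def)
  next
    fix s
    have "(\<Sum>c<n. z c (Suc s) - z c s) \<le>
        (\<Sum>c<n. (progress I R c (Suc s) - progress I R c s) + (y c (Suc s) - y c s))"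
    proof (rule sum_mono)
      fix c assume "c \<in> {..<n}"
      then show "z c (Suc s) - z c s \<le> (progress I R c (Suc s) - progress I R c s) + (y c (Suc s) - y c s)"
        using R.progress_mono[of c s "Suc s"] y_mono[of s "Suc s" c] by (auto simp: z_def max_def)
    qed
    also have "\<dots> \<le> 1 + (\<Sum>c<n. y c (Suc s) - y c s)"
      unfolding sum.distrib by (intro add_right_mono R.sum_progress_step_le)
    also have "(\<Sum>c<n. y c (Suc s) - y c s) =
        (\<Sum>c<n. if c \<in> ?over then progress ?J R' (pos c) (Suc s) - progress ?J R' (pos c) s else 0)"
      by (intro sum.cong) (auto simp: y_def)
    also have "\<dots> = (\<Sum>k<length ?J. progress ?J R' k (Suc s) - progress ?J R' k s)" by (rule over_sum)
    also have "\<dots> \<le> 1" by (rule R'.sum_progress_step_le)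
    finally show "(\<Sum>c<n. z c (Suc s) - z c s) \<le> 2" by simp
  qed simp
  also have "(\<Sum>s<Suc T\<^sub>0. \<Sum>c<n. level c (z c s)) \<le>
      (\<Sum>s<Suc T\<^sub>0. \<Sum>c<n. residual I R c s + r c s)"
  proof (intro sum_mono)
    fix s c assume "c \<in> {..<n}"
    then have c: "c < n" by simp
    note v = valid_instanceD[OF valid c]
    have res_nonneg: "residual I R c s \<ge> 0"
      unfolding residual_def using v by (intro sum_nonneg) auto
    have r_eq: "r c s = (Wh ! c - total_weight (I ! c)) * of_bool (\<not> completed ?J (received R' s) (pos c, 0))"
      if "c \<in> ?over"
      using that by (simp add: r_def residual_def pos(2) over_chain_def)
    have r_nonneg: "r c s \<ge> 0"
      using r_eq by (cases "c \<in> ?over") (auto simp: r_def)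
    show "level c (z c s) \<le> residual I R c s + r c s"
    proof (cases "z c s < total_proc (I ! c)")
      case False
      then show ?thesis using res_nonneg r_nonneg by (simp add: level_def)
    next
      case True
      have "(\<Sum>i<length (I ! c). weight (I ! c ! i)) - residual I R c s \<le>
          (\<Sum>i<length (I ! c). weight (I ! c ! i) * of_bool (total_proc (take (Suc i) (I ! c)) \<le> z c s))"
        unfolding residual_def sum_subtractf[symmetric]
      proof (rule sum_mono)
        fix i assume "i \<in> {..<length (I ! c)}"
        then have i: "i < length (I ! c)" by simp
        have "total_proc (take (Suc i) (I ! c)) \<le> z c s" if "completed I (received R s) (c, i)"
          using R.completed_progress[OF c i that] by (simp add: z_def)
        then show "weight (I ! c ! i) - weight (I ! c ! i) * of_bool (\<not> completed I (received R s) (c, i))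
            \<le> weight (I ! c ! i) * of_bool (total_proc (take (Suc i) (I ! c)) \<le> z c s)"
          using v(5)[OF i] by auto
      qed
      moreover have "(\<Sum>i<length (I ! c). weight (I ! c ! i)) = total_weight (I ! c)"
        using total_weight_take[of "length (I ! c)" "I ! c"] by simp
      moreover have "Wh ! c - total_weight (I ! c) \<le> r c s"
      proof (cases "c \<in> ?over")
        case over: True
        have J: "?J ! pos c = [Job (total_proc (I ! c)) (Wh ! c - total_weight (I ! c))]"
          using over by (simp add: pos(2) over_chain_def)
        \<comment> \<open>The single job of the overpredicted chain requires as much processing as
          the whole chain \<open>c\<close>, so it cannot be completed while \<open>z\<close> is
          below that amount.\<close>
        have "\<not> completed ?J (received R' s) (pos c, 0)"
        proof
          assume "completed ?J (received R' s) (pos c, 0)"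
          from R'.completed_progress[OF pos_less[OF over] _ this] have "total_proc (I ! c) \<le> y c s"
            using over by (simp add: J total_proc_def y_def)
          with True show False by (simp add: z_def)
        qed
        then show ?thesis using r_eq[OF over] by simp
      next
        case False
        then show ?thesis using c by (simp add: r_def)
      qed
      ultimately show ?thesis using True res_nonneg r_nonneg by (simp add: level_def)
    qed
  qed
  also have "\<dots> = (\<Sum>s<Suc T\<^sub>0. \<Sum>c<n. residual I R c s) + (\<Sum>s<Suc T\<^sub>0. \<Sum>k<length ?J. residual ?J R' k s)"
    unfolding sum.distrib r_def
    by (intro arg_cong2[where f = "(+)"] sum.cong refl over_sum[of "\<lambda>k. residual ?J R' k s" for s])
  also have "\<dots> \<le> cost I R + cost ?J R'"
    by (intro add_mono R.sum_residual_le_cost R'.sum_residual_le_cost)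
  finally show ?thesis by simp
qed

text \<open>The coefficient 37 is 5 for wasted steps and the damping they cause, plus 32 from the
  path comparison.\<close>

lemma cost_sched_le:
  assumes R: "feasible I R" and R': "feasible (C_over I Wh) R'" and R'': "feasible (C_under I Wh) R''"
  shows "cost I sched \<le> 37 * cost I R + 32 * cost (C_over I Wh) R' + 2 * real n * cost (C_under I Wh) R''"
proof -
  obtain N where N: "cost I sched = (\<Sum>c<n. \<Sum>t<N. rem_weight c t)" by (rule cost_sched)
  have "cost I sched \<le> (\<Sum>c<n. 5 * (\<Sum>t\<in>waste_steps c N. rem_weight c t) +
      (\<Sum>t<N. dclaim c t) + 2 * real n * under_load c)"
    unfolding N by (intro sum_mono sum_rem_weight_le) simp
  also have "\<dots> = 5 * (\<Sum>c<n. \<Sum>t\<in>waste_steps c N. rem_weight c t) +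
      (\<Sum>c<n. \<Sum>t<N. dclaim c t) + 2 * real n * (\<Sum>c<n. under_load c)"
    by (simp only: sum.distrib sum_distrib_left)
  also have "(\<Sum>c<n. \<Sum>t<N. dclaim c t) = (\<Sum>t<N. total_claim t)"
    unfolding total_claim_def by (rule sum.swap)
  also have "5 * (\<Sum>c<n. \<Sum>t\<in>waste_steps c N. rem_weight c t) + (\<Sum>t<N. total_claim t) +
      2 * real n * (\<Sum>c<n. under_load c)
    \<le> 5 * cost I R + 32 * (cost I R + cost (C_over I Wh) R') + 2 * real n * cost (C_under I Wh) R''"
    by (intro add_mono mult_left_mono waste_rem_weight_le sum_total_claim_le_cost sum_under_load_le assms) auto
  finally show ?thesis by simp
qed

end

section \<open>From feasible schedules to optimal values\<close>

lemma cost_nonneg: "valid_instance I \<Longrightarrow> cost I R \<ge> 0"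
  unfolding cost_def
  by (intro sum_nonneg) (auto simp: job_ids_def dest: valid_instanceD(5))

text \<open>The algorithm itself, run with predictions 0, is a witness. This makes the set in the
  definition of \<open>Opt\<close> nonempty, also for the instances derived from
  \<open>I\<close>.\<close>

lemma exists_feasible:
  assumes "valid_instance I" shows "\<exists>R. feasible I R"
proof -
  interpret damped_run I "replicate (length I) 0" by unfold_locales (use assms in auto)
  show ?thesis using feasible_sched by blast
qed

lemma Opt_greatest:
  assumes "valid_instance I" "\<And>R. feasible I R \<Longrightarrow> y \<le> cost I R"
  shows "y \<le> Opt I"
  unfolding Opt_def using assms exists_feasible[OF assms(1)] by (intro cInf_greatest) auto

text \<open>The bound passes to the infimum after division by \<open>k\<close>. For
  \<open>k = 0\<close> one feasible schedule is enough.\<close>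

lemma le_mult_Opt:
  assumes "valid_instance I" "k \<ge> 0" "\<And>R. feasible I R \<Longrightarrow> y \<le> x + k * cost I R"
  shows "y \<le> x + k * Opt I"
proof (cases "k = 0")
  case True
  then show ?thesis using assms exists_feasible[OF assms(1)] by auto
next
  case False
  then have k: "k > 0" using assms(2) by simp
  have "(y - x) / k \<le> Opt I"
    by (rule Opt_greatest[OF assms(1)]) (use assms(3) k in \<open>force simp: pos_divide_le_eq algebra_simps\<close>)
  then show ?thesis using k by (simp add: pos_divide_le_eq algebra_simps)
qed

theorem theorem7:
  "\<exists>(A :: algorithm) (K :: real). K > 0 \<and>
     (\<forall>(I :: chain_instance) (Wh :: real list).
        valid_instance I \<and> length Wh = length I \<longrightarrow>
          feasible I (alg_schedule A Wh I) \<and>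
          cost I (alg_schedule A Wh I) \<le>
            K * min (1 + (Opt (C_over I Wh) + real (length I) * Opt (C_under I Wh)) / Opt I)
                    (real (length I)) * Opt I)"
proof (intro exI[of _ damped_rr] exI[of _ "37::real"] conjI allI impI)
  fix I :: chain_instance and Wh :: "real list"
  assume "valid_instance I \<and> length Wh = length I"
  then interpret damped_run I Wh by unfold_locales auto
  let ?O = "Opt I" and ?Oo = "Opt (C_over I Wh)" and ?Ou = "Opt (C_under I Wh)"
  note valid_over = valid_C_over[OF valid len] and valid_under = valid_C_under[OF valid len]
  show "feasible I sched" by (rule feasible_sched)
  have nonneg: "?O \<ge> 0" "?Oo \<ge> 0" "?Ou \<ge> 0"
    by (intro Opt_greatest cost_nonneg valid valid_over valid_under)+
  have width: "cost I sched \<le> 0 + (1 + 2 * real n) * ?O"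
    by (rule le_mult_Opt[OF valid]) (use cost_sched_le_width in auto)
  \<comment> \<open>The three schedules are independent, so the infima are taken one after another:
    over \<open>I\<close>, the overpredicted and the underpredicted instance.\<close>
  have "cost I sched \<le> 32 * cost (C_over I Wh) R' + 2 * real n * cost (C_under I Wh) R'' + 37 * ?O"
    if "feasible (C_over I Wh) R'" "feasible (C_under I Wh) R''" for R' R''
    by (rule le_mult_Opt[OF valid]) (use cost_sched_le[OF _ that] in \<open>auto simp: algebra_simps\<close>)
  then have "cost I sched \<le> (37 * ?O + 2 * real n * cost (C_under I Wh) R'') + 32 * ?Oo"
    if "feasible (C_under I Wh) R''" for R''
    by (rule_tac le_mult_Opt[OF valid_over]) (use that in \<open>auto simp: algebra_simps\<close>)
  then have refined: "cost I sched \<le> (37 * ?O + 32 * ?Oo) + 2 * real n * ?Ou"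
    by (rule_tac le_mult_Opt[OF valid_under]) (auto simp: algebra_simps)
  show "cost I sched \<le> 37 * min (1 + (?Oo + real n * ?Ou) / ?O) (real n) * ?O"
  \<comment> \<open>If the optimum is 0, the right-hand side is 0 whatever the quotient is, and the
    width bound already forces cost at most 0.\<close>
  proof (cases "?O = 0")
    case True
    then show ?thesis using width by simp
  next
    case False
    then have pos: "?O > 0" using nonneg by simp
    \<comment> \<open>A positive optimum requires a chain. Then \<open>1 + 2 * real n\<close> is at
      most \<open>37 * real n\<close>.\<close>
    have "n > 0"
    proof (rule ccontr)
      assume "\<not> n > 0"
      then have "cost I R = 0" for R by (simp add: cost_def job_ids_def)
      then have "Opt I \<le> 0"
        unfolding Opt_def using exists_feasible[OF valid] by (auto simp: image_def)
      with pos show False by simp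
    qed
    then have "1 \<le> real n" by linarith
    then have "(1 + 2 * real n) * ?O \<le> (37 * real n) * ?O"
      using pos by (intro mult_right_mono) auto
    then have "cost I sched \<le> 37 * (real n * ?O)" using width by simp
    moreover have "cost I sched \<le> 37 * (?O + (?Oo + real n * ?Ou))"
    proof -
      have "0 \<le> real n * ?Ou" using nonneg by simp
      then show ?thesis using refined nonneg(2) unfolding distrib_left mult.assoc by linarith
    qed
    moreover have "(1 + (?Oo + real n * ?Ou) / ?O) * ?O = ?O + (?Oo + real n * ?Ou)"
      using pos by (simp add: field_simps)
    ultimately show ?thesis
      by (cases "1 + (?Oo + real n * ?Ou) / ?O \<le> real n") (simp_all only: min_def mult.assoc if_True if_False)
  qed
qed simp

end
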